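(* Let $E:[1,\infty)\to\mathbb C$ be measurable and $\beta\in\mathbb R$, with $$\int_1^\infty|E(x)|x^{-\sigma-1}\,dx<\infty\qquad(\sigma>\beta),$$ and put $M_E(s)=\int_1^\infty E(x)x^{-s-1}\,dx$ for $\operatorname{Re}s>\beta$. Let $\Gamma=(\gamma_1,\dots,\gamma_m)$ be distinct real numbers and $\rho_j=\beta+i\gamma_j$. Suppose that for each $j$ there is, on a neighborhood of $\rho_j$, a meromorphic continuation of $M_E$ that agrees with the Mellin integral on the interior side of that neighborhood (the part with $\operatorname{Re}s>\beta$) and has a simple pole at $\rho_j$ with residue $r_j$. Then, with $r=(r_1,\dots,r_m)$, $$A_\beta(E)\ge q_\Gamma(r)\ge\|r\|_2.$$
   Context: $A_\beta(E):=\lim_{X\to\infty}\operatorname{ess\,sup}_{x\ge X}|E(x)|/x^\beta\in[0,\infty]$, the essential supremum being with respect to $dx/x$. With $\Phi_\Gamma(y)=(e^{i\gamma_1y},\dots,e^{i\gamma_my})$, let $G_\Gamma=\overline{\Phi_\Gamma(\mathbb R)}\subseteq\mathbb T^m$ (closure in the torus, a compact group) with Haar probability measure $m_\Gamma$ and coordinate characters $\chi_j(z)=z_j$. Then $$q_\Gamma(a)=\inf\Bigl\{\|f\|_{L^\infty(G_\Gamma)}:\ f\in L^\infty(G_\Gamma),\ \int_{G_\Gamma}f\overline{\chi_j}\,dm_\Gamma=a_j\ (1\le j\le m)\Bigr\}.$$ $\|r\|_2=(\sum_j|r_j|^2)^{1/2}$. *)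

theory Defs
  imports "HOL-Complex_Analysis.Complex_Analysis" "HOL-Probability.Probability"
    "HOL-Probability.Essential_Supremum"
begin

definition mellin :: "(real \<Rightarrow> complex) \<Rightarrow> complex \<Rightarrow> complex" where
  "mellin E s = (LINT x|lebesgue_on {1..}. E x * complex_of_real x powr (- s - 1))"

definition mult_measure_from :: "real \<Rightarrow> real measure" where
  "mult_measure_from X = density (lebesgue_on {X..}) (\<lambda>x. ennreal (1 / x))"

text \<open>The essential supremum is nonincreasing in \<open>X\<close>, so the limit exists in \<open>[0,\<infinity>]\<close>.
  Only large \<open>X\<close> matter, so the values of \<open>E\<close> outside \<open>[1,\<infinity>)\<close> are irrelevant.\<close>

definition ess_growth :: "real \<Rightarrow> (real \<Rightarrow> complex) \<Rightarrow> ennreal" where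
  "ess_growth \<beta> E = Lim at_top
     (\<lambda>X::real. esssup (mult_measure_from X) (\<lambda>x. ennreal (cmod (E x) / x powr \<beta>)))"

definition torus_curve :: "real ^ 'm \<Rightarrow> real \<Rightarrow> complex ^ 'm::finite" where
  "torus_curve \<Gamma> y = (\<chi> j. exp (\<i> * complex_of_real (\<Gamma> $ j * y)))"

text \<open>The torus is closed in \<open>complex ^ 'm\<close>, so the closure taken there is the closure in
  the torus. The group operation is the componentwise product \<open>*\<close> of vectors.\<close>

definition torus_hull :: "real ^ 'm \<Rightarrow> (complex ^ 'm::finite) set" where
  "torus_hull \<Gamma> = closure (range (torus_curve \<Gamma>))"

definition is_haar_prob :: "(complex ^ 'm::finite) set \<Rightarrow> (complex ^ 'm) measure \<Rightarrow> bool" where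
  "is_haar_prob G \<mu> \<longleftrightarrow> prob_space \<mu> \<and> sets \<mu> = sets (restrict_space borel G) \<and>
     (\<forall>g\<in>G. distr \<mu> \<mu> (\<lambda>z. g * z) = \<mu>)"

definition haar_prob :: "(complex ^ 'm::finite) set \<Rightarrow> (complex ^ 'm) measure" where
  "haar_prob G = (THE \<mu>. is_haar_prob G \<mu>)"

definition Linf_norm :: "'a measure \<Rightarrow> ('a \<Rightarrow> complex) \<Rightarrow> ennreal" where
  "Linf_norm M f = esssup M (\<lambda>z. ennreal (cmod (f z)))"

definition Linf :: "'a measure \<Rightarrow> ('a \<Rightarrow> complex) set" where
  "Linf M = {f \<in> borel_measurable M. Linf_norm M f < \<infinity>}"

definition q_interp :: "real ^ 'm \<Rightarrow> complex ^ 'm::finite \<Rightarrow> ennreal" where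
  "q_interp \<Gamma> a = (let \<mu> = haar_prob (torus_hull \<Gamma>) in
     Inf {Linf_norm \<mu> f | f. f \<in> Linf \<mu> \<and> (\<forall>j. (LINT z|\<mu>. f z * cnj (z $ j)) = a $ j)})"

definition has_simple_pole_with_residue ::
    "(complex \<Rightarrow> complex) \<Rightarrow> complex \<Rightarrow> complex \<Rightarrow> bool" where
  "has_simple_pole_with_residue F \<rho> c \<longleftrightarrow> is_pole F \<rho> \<and> zorder F \<rho> = -1 \<and> residue F \<rho> = c"

end

theory Submission
  imports Defs "HOL-Analysis.Kronecker_Approximation_Theorem"
begin

text \<open>
  Let \<open>G\<close> be the closure of the curve \<open>y \<mapsto> (exp (\<i> * \<gamma>\<^sub>j * y))\<^sub>j\<close> in the torus and \<open>c\<close> a number above the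
  essential growth of \<open>E\<close>. For a vector \<open>a\<close> put \<open>P z = (\<Sum>j. a\<^sub>j * z\<^sub>j)\<close>. The residue \<open>r\<^sub>j\<close> is the limit
  of \<open>\<delta> * M\<^sub>E (\<rho>\<^sub>j + \<delta>)\<close> as \<open>\<delta>\<close> decreases to \<open>0\<close>. Hence \<open>\<Sum>j. cnj a\<^sub>j * r\<^sub>j\<close> is the limit of
  the integrals of \<open>E x * x powr (- \<beta>)\<close> times \<open>cnj (P z)\<close>, with \<open>z\<close> the point of the curve at \<open>y = ln x\<close>, against
  the probability measure with density \<open>\<delta> * x powr (- \<delta> - 1)\<close> on \<open>[1, \<infinity>)\<close>. As \<open>E x * x powr (- \<beta>)\<close> is
  eventually at most \<open>c\<close> in modulus, and as the curve is equidistributed in \<open>G\<close> for these measures (\<open>equidistribution\<close>),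
  the modulus of \<open>\<Sum>j. cnj a\<^sub>j * r\<^sub>j\<close> is at most \<open>c\<close> times the mean of \<open>cmod (P z)\<close> over \<open>G\<close> (\<open>residue_dual_bound\<close>).

  These inequalities for all \<open>a\<close> are dual to the existence of an interpolating function. The coefficient
  vectors of functions bounded by \<open>c\<close> form a convex set in a finite-dimensional space; a hyperplane that
  separates \<open>r\<close> from its closure would violate the inequality for its normal vector (\<open>dual_bound_imp_closure\<close>).
  So \<open>r\<close> lies in the closure, and a small trigonometric correction attains \<open>r\<close> with a bound arbitrarily close to \<open>c\<close>
  (\<open>closure_coeffs_ball_interpolation\<close>). Thus the interpolation constant is at most \<open>c\<close>.

  The second inequality is Bessel's inequality: the coordinate characters are orthonormal because the
  frequencies are distinct (\<open>norm_coeffs_le_Linf_norm\<close>).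

  The Haar measure itself has to be produced, since it is specified by a definite description. The
  frequencies generate a free abelian group; in a basis of it, Kronecker's theorem identifies \<open>G\<close> with the image of
  a torus under an integer matrix (\<open>torus_hull_eq_torus_image\<close>), that is with the product
  of finitely many circle subgroups, and the convolution of the uniform measures on the circles is invariant. Uniqueness is Fubini's theorem.
\<close>

section \<open>Integer bases\<close>

definition int_independent :: "real set \<Rightarrow> bool" where
  "int_independent B \<longleftrightarrow> (\<forall>u::real \<Rightarrow> int. (\<Sum>v\<in>B. of_int (u v) * v) = 0 \<longrightarrow> (\<forall>v\<in>B. u v = 0))"

definition int_combination :: "real set \<Rightarrow> real \<Rightarrow> bool" where
  "int_combination B x \<longleftrightarrow> (\<exists>u::real \<Rightarrow> int. x = (\<Sum>v\<in>B. of_int (u v) * v))"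

text \<open>Dividing a basis by an integer makes room for a number whose multiple was already in the lattice:
this is how linear dependence over the rationals is turned into membership in a lattice.\<close>

lemma int_combination_scaled_base:
  fixes N :: int
  assumes N: "N \<noteq> 0" and x: "of_int N * x = (\<Sum>v\<in>B. of_int (u v) * v)"
  shows "int_combination ((\<lambda>v. v / of_int N) ` B) x"
proof -
  have inj: "inj_on (\<lambda>v::real. v / of_int N) B"
    using N by (auto simp: inj_on_def)
  have "(\<Sum>w\<in>(\<lambda>v. v / of_int N) ` B. of_int (u (w * of_int N)) * w)
      = (\<Sum>v\<in>B. of_int (u v) * v) / of_int N"
    using N by (subst sum.reindex[OF inj]) (simp add: sum_divide_distrib)
  also have "\<dots> = x"
    using N x by (simp add: field_simps)
  finally show ?thesis
    unfolding int_combination_def by (intro exI[of _ "\<lambda>w. u (w * of_int N)"]) simp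
qed

lemma int_independent_scale:
  fixes N :: int
  assumes N: "N \<noteq> 0" and B: "int_independent B"
  shows "int_independent ((\<lambda>v. v / of_int N) ` B)"
  unfolding int_independent_def
proof (intro allI impI)
  fix u :: "real \<Rightarrow> int"
  assume z: "(\<Sum>v\<in>(\<lambda>v. v / of_int N) ` B. of_int (u v) * v) = 0"
  have inj: "inj_on (\<lambda>v::real. v / of_int N) B"
    using N by (auto simp: inj_on_def)
  have "(\<Sum>v\<in>B. of_int (u (v / of_int N)) * v) / of_int N = 0"
    using z N by (subst (asm) sum.reindex[OF inj]) (simp add: sum_divide_distrib)
  then have "\<forall>v\<in>B. u (v / of_int N) = 0"
    using B[unfolded int_independent_def, rule_format, of "\<lambda>v. u (v / of_int N)"] N by simp
  then show "\<forall>v\<in>(\<lambda>v. v / of_int N) ` B. u v = 0" by auto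
qed

text \<open>A finitely generated subgroup of the reals is torsion free, hence free. The induction needs no
structure theory: a new number that has no nonzero multiple in the current lattice joins the basis,
and otherwise the basis is divided by the integer that exhibits such a multiple.\<close>

lemma exists_integer_basis:
  assumes "finite S"
  shows "\<exists>B. finite B \<and> int_independent B \<and> (\<forall>x\<in>S. int_combination B x)"
  using assms
proof (induction S rule: finite_induct)
  case empty
  then show ?case
    by (intro exI[of _ "{}"]) (simp add: int_independent_def)
next
  case (insert x S)
  then obtain B where B: "finite B" "int_independent B" "\<And>s. s \<in> S \<Longrightarrow> int_combination B s"
    by blast
  show ?case
  proof (cases "\<exists>N::int. \<exists>u. N \<noteq> 0 \<and> of_int N * x = (\<Sum>v\<in>B. of_int (u v) * v)")
    case True
    then obtain N :: int and u where N: "N \<noteq> 0" and x: "of_int N * x = (\<Sum>v\<in>B. of_int (u v) * v)"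
      by blast
    have "int_combination ((\<lambda>v. v / of_int N) ` B) s" if "s \<in> S" for s
    proof -
      obtain w where w: "s = (\<Sum>v\<in>B. of_int (w v) * v)"
        using B(3)[OF \<open>s \<in> S\<close>] by (auto simp: int_combination_def)
      have "of_int N * s = (\<Sum>v\<in>B. of_int (N * w v) * v)"
        by (simp add: w sum_distrib_left mult.assoc)
      then show ?thesis by (rule int_combination_scaled_base[OF N])
    qed
    then show ?thesis
      using int_combination_scaled_base[OF N x] int_independent_scale[OF N B(2)] B(1)
      by (intro exI[of _ "(\<lambda>v. v / of_int N) ` B"]) auto
  next
    case False
    have xB: "x \<notin> B"
    proof
      assume "x \<in> B"
      then have "of_int 1 * x = (\<Sum>v\<in>B. of_int (if v = x then 1 else 0) * v)"
        using B(1) by (subst sum.remove[OF B(1) \<open>x \<in> B\<close>]) simp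
      then have "\<exists>N::int. \<exists>u. N \<noteq> 0 \<and> of_int N * x = (\<Sum>v\<in>B. of_int (u v) * v)"
        by (intro exI[of _ 1] exI[of _ "\<lambda>v. if v = x then 1 else 0"]) simp
      with False show False by (rule notE)
    qed
    have "int_independent (insert x B)"
      unfolding int_independent_def
    proof (intro allI impI)
      fix u :: "real \<Rightarrow> int"
      assume "(\<Sum>v\<in>insert x B. of_int (u v) * v) = 0"
      then have z: "of_int (u x) * x + (\<Sum>v\<in>B. of_int (u v) * v) = 0"
        using B(1) xB by simp
      then have "of_int (u x) * x = (\<Sum>v\<in>B. of_int (- u v) * v)"
        by (simp add: sum_negf)
      have "u x = 0"
      proof (rule ccontr)
        assume "u x \<noteq> 0"
        with \<open>of_int (u x) * x = _\<close>
        have "\<exists>N::int. \<exists>u. N \<noteq> 0 \<and> of_int N * x = (\<Sum>v\<in>B. of_int (u v) * v)"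
          by (intro exI[of _ "u x"] exI[of _ "\<lambda>v. - u v"]) simp
        with False show "False" by (rule notE)
      qed
      moreover have "\<forall>v\<in>B. u v = 0"
        using z \<open>u x = 0\<close> B(2) by (simp add: int_independent_def)
      ultimately show "\<forall>v\<in>insert x B. u v = 0" by simp
    qed
    moreover have "int_combination (insert x B) s" if "s \<in> insert x S" for s
    proof (cases "s = x")
      case True
      have "(\<Sum>v\<in>B. of_int (if v = x then 1 else 0) * v) = (0::real)"
        using xB by (intro sum.neutral) auto
      then show ?thesis
        unfolding int_combination_def using B(1) xB True
        by (intro exI[of _ "\<lambda>v. if v = x then 1 else 0"]) simp
    next
      case False
      then obtain w where w: "s = (\<Sum>v\<in>B. of_int (w v) * v)"
        using B(3)[of s] \<open>s \<in> insert x S\<close> by (auto simp: int_combination_def)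
      have "(\<Sum>v\<in>B. of_int ((w(x:=0)) v) * v) = (\<Sum>v\<in>B. of_int (w v) * v)"
        using xB by (intro sum.cong) auto
      then show ?thesis
        unfolding int_combination_def using B(1) xB w
        by (intro exI[of _ "w(x:=0)"]) simp
    qed
    ultimately show ?thesis using B(1) by blast
  qed
qed

section \<open>Invariant measures\<close>

lemma continuous_on_vec_times [continuous_intros]:
  fixes f g :: "'a::topological_space \<Rightarrow> complex ^ 'm::finite"
  assumes "continuous_on S f" "continuous_on S g"
  shows "continuous_on S (\<lambda>x. f x * g x)"
  unfolding times_vec_def using assms by (intro continuous_intros)

lemma borel_measurable_vec_times [measurable]:
  fixes f g :: "'a \<Rightarrow> complex ^ 'm::finite"
  assumes [measurable]: "f \<in> borel_measurable M" "g \<in> borel_measurable M"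
  shows "(\<lambda>x. f x * g x) \<in> borel_measurable M"
proof -
  have "continuous_on UNIV (\<lambda>p::(complex ^ 'm) \<times> (complex ^ 'm). fst p * snd p)"
    by (intro continuous_intros)
  from borel_measurable_continuous_Pair[OF assms this] show ?thesis by simp
qed

lemma borel_measurable_vec_component [measurable]:
  "(\<lambda>z::complex ^ 'm::finite. z $ j) \<in> borel_measurable borel"
  by (intro borel_measurable_continuous_onI continuous_intros)

text \<open>The measures are kept on the Borel sets of the whole space and only concentrated on \<open>K\<close>, so that
measures on different subgroups can be convolved without changing the sigma-algebra.\<close>

definition invariant_prob_on :: "(complex ^ 'm::finite) set \<Rightarrow> (complex ^ 'm) measure \<Rightarrow> bool" where
  "invariant_prob_on K \<mu> \<longleftrightarrow> prob_space \<mu> \<and> sets \<mu> = sets borel \<and> (AE z in \<mu>. z \<in> K) \<and>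
     (\<forall>g\<in>K. distr \<mu> borel (\<lambda>z. g * z) = \<mu>)"

text \<open>The convolution of the two measures is invariant because a translation by \<open>k * c\<close> can be split, by
commutativity, into the translation by \<open>k\<close> of the first factor and by \<open>c\<close> of the second.\<close>

lemma invariant_prob_on_product:
  assumes \<mu>: "invariant_prob_on K \<mu>" and \<nu>: "invariant_prob_on C \<nu>" and "closed K" "closed C"
    and KC: "KC = (\<lambda>(x, y). x * y) ` (K \<times> C)" "closed KC"
  shows "invariant_prob_on KC (distr (\<mu> \<Otimes>\<^sub>M \<nu>) borel (\<lambda>(x, y). x * y))"
proof -
  interpret \<mu>: prob_space \<mu> using \<mu> by (simp add: invariant_prob_on_def)
  interpret \<nu>: prob_space \<nu> using \<nu> by (simp add: invariant_prob_on_def)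
  interpret P: pair_prob_space \<mu> \<nu> ..
  have sets[measurable_cong, simp]: "sets \<mu> = sets borel" "sets \<nu> = sets borel"
    using \<mu> \<nu> by (simp_all add: invariant_prob_on_def)
  have [measurable]: "K \<in> sets borel" "C \<in> sets borel" "KC \<in> sets borel"
    using assms by (auto intro: borel_closed)
  let ?m = "\<lambda>(x, y). x * y :: complex ^ 'm"
  have mult[measurable]: "?m \<in> borel_measurable (\<mu> \<Otimes>\<^sub>M \<nu>)"
    by measurable
  have inK: "AE p in \<mu> \<Otimes>\<^sub>M \<nu>. ?m p \<in> KC"
  proof -
    have 1: "AE x in \<mu>. x \<in> K" and 2: "AE y in \<nu>. y \<in> C"
      using \<mu> \<nu> by (auto simp: invariant_prob_on_def)
    have "AE x in \<mu>. AE y in \<nu>. x * y \<in> KC"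
      using 1
    proof eventually_elim
      case (elim x)
      show ?case using 2 by eventually_elim (use elim KC in auto)
    qed
    moreover have "{p \<in> space (\<mu> \<Otimes>\<^sub>M \<nu>). ?m p \<in> KC} \<in> sets (\<mu> \<Otimes>\<^sub>M \<nu>)"
      using measurable_sets[OF mult, of KC] by (simp add: vimage_def Int_def conj_commute)
    ultimately show ?thesis
      by (intro P.AE_pair_measure) (simp_all add: case_prod_beta)
  qed
  have inv: "distr (distr (\<mu> \<Otimes>\<^sub>M \<nu>) borel ?m) borel (\<lambda>z. g * z) = distr (\<mu> \<Otimes>\<^sub>M \<nu>) borel ?m"
    if "g \<in> KC" for g
  proof -
    from that obtain k c where g: "g = k * c" "k \<in> K" "c \<in> C" using KC by auto
    have k: "distr \<mu> borel (\<lambda>z. k * z) = \<mu>" and c: "distr \<nu> borel (\<lambda>z. c * z) = \<nu>"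
      using \<mu> \<nu> g by (auto simp: invariant_prob_on_def)
    have "distr (distr (\<mu> \<Otimes>\<^sub>M \<nu>) borel ?m) borel (\<lambda>z. g * z)
        = distr (\<mu> \<Otimes>\<^sub>M \<nu>) borel (\<lambda>p. g * ?m p)"
      by (subst distr_distr) (auto simp: comp_def)
    also have "(\<lambda>p. g * ?m p) = ?m \<circ> (\<lambda>(x, y). (k * x, c * y))"
      by (auto simp: fun_eq_iff g ac_simps)
    also have "distr (\<mu> \<Otimes>\<^sub>M \<nu>) borel (?m \<circ> (\<lambda>(x, y). (k * x, c * y)))
        = distr (distr (\<mu> \<Otimes>\<^sub>M \<nu>) (borel \<Otimes>\<^sub>M borel) (\<lambda>(x, y). (k * x, c * y))) borel ?m"
      by (subst distr_distr) auto
    also have "distr (\<mu> \<Otimes>\<^sub>M \<nu>) (borel \<Otimes>\<^sub>M borel) (\<lambda>(x, y). (k * x, c * y))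
        = distr \<mu> borel (\<lambda>z. k * z) \<Otimes>\<^sub>M distr \<nu> borel (\<lambda>z. c * z)"
      by (rule pair_measure_distr[symmetric])
         (auto simp: c \<nu>.sigma_finite_measure_axioms)
    finally show ?thesis by (simp only: k c)
  qed
  show ?thesis
    unfolding invariant_prob_on_def using inK inv
    by (auto simp: P.prob_space_distr AE_distr_iff case_prod_beta)
qed

section \<open>Circles\<close>

text \<open>The shift may be reduced to its fractional part \<open>a\<close>; the piece of the window that sticks out beyond
\<open>1\<close> is then moved back by one period.\<close>

lemma nn_integral_periodic:
  fixes h :: "real \<Rightarrow> ennreal"
  assumes [measurable]: "h \<in> borel_measurable borel" and per: "\<And>t. h (t + 1) = h t"
  shows "(\<integral>\<^sup>+t. h (t + s) * indicator {0..<1} t \<partial>lborel) = (\<integral>\<^sup>+t. h t * indicator {0..<1} t \<partial>lborel)"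
proof -
  have perN: "h (t + real n) = h t" for t n
  proof (induction n)
    case (Suc n)
    then show ?case using per[of "t + real n"] by (simp add: ac_simps)
  qed simp
  have perZ: "h (t + of_int k) = h t" for t k
  proof (cases "k \<ge> 0")
    case True
    then show ?thesis using perN[of t "nat k"] by simp
  next
    case False
    then show ?thesis using perN[of "t + of_int k" "nat (-k)"] by simp
  qed
  define a where "a = frac s"
  have a: "0 \<le> a" "a < 1" by (auto simp: a_def frac_lt_1)
  have hs: "h (t + s) = h (t + a)" for t
    using perZ[of "t + a" "\<lfloor>s\<rfloor>"] by (simp add: a_def frac_def)
  have "(\<integral>\<^sup>+t. h (t + s) * indicator {0..<1} t \<partial>lborel) = (\<integral>\<^sup>+t. h (t + a) * indicator {a..<a+1} (t + a) \<partial>lborel)"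
    unfolding hs by (intro nn_integral_cong) (auto split: split_indicator)
  also have "\<dots> = (\<integral>\<^sup>+t. h t * indicator {a..<a+1} t \<partial>lborel)"
    using nn_integral_real_affine[of "\<lambda>t. h t * indicator {a..<a+1} t" 1 a] by (simp add: add.commute)
  also have "\<dots> = (\<integral>\<^sup>+t. h t * indicator {a..<1} t + h t * indicator {1..<a+1} t \<partial>lborel)"
    using a by (intro nn_integral_cong) (auto split: split_indicator)
  also have "\<dots> = (\<integral>\<^sup>+t. h t * indicator {a..<1} t \<partial>lborel) + (\<integral>\<^sup>+t. h t * indicator {1..<a+1} t \<partial>lborel)"
    by (rule nn_integral_add) auto
  also have "(\<integral>\<^sup>+t. h t * indicator {1..<a+1} t \<partial>lborel) = (\<integral>\<^sup>+t. h (1 + t) * indicator {1..<a+1} (1 + t) \<partial>lborel)"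
    using nn_integral_real_affine[of "\<lambda>t. h t * indicator {1..<a+1} t" 1 1] by simp
  also have "\<dots> = (\<integral>\<^sup>+t. h t * indicator {0..<a} t \<partial>lborel)"
    using per by (intro nn_integral_cong) (auto split: split_indicator simp: add.commute)
  also have "(\<integral>\<^sup>+t. h t * indicator {a..<1} t \<partial>lborel) + (\<integral>\<^sup>+t. h t * indicator {0..<a} t \<partial>lborel)
      = (\<integral>\<^sup>+t. h t * indicator {a..<1} t + h t * indicator {0..<a} t \<partial>lborel)"
    by (rule nn_integral_add[symmetric]) auto
  also have "\<dots> = (\<integral>\<^sup>+t. h t * indicator {0..<1} t \<partial>lborel)"
    using a by (intro nn_integral_cong) (auto split: split_indicator)
  finally show ?thesis .
qed

text \<open>The closed one-parameter subgroup of the torus with integer direction \<open>a\<close>; one period is the unit interval.\<close>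

definition wind :: "('m \<Rightarrow> int) \<Rightarrow> real \<Rightarrow> complex ^ 'm::finite" where
  "wind a t = (\<chi> j. cis (2 * pi * (of_int (a j) * t)))"

lemma wind_add: "wind a (s + t) = wind a s * wind a t"
  by (simp add: wind_def vec_eq_iff cis_mult algebra_simps)

lemma wind_1: "wind a 1 = 1"
  by (simp add: wind_def vec_eq_iff cis_multiple_2pi)

lemma continuous_on_wind [continuous_intros]: "continuous_on S (wind a)"
  unfolding wind_def by (intro continuous_intros)

lemma wind_int: "wind a (of_int k) = 1"
  using cis_multiple_2pi[of "of_int (a _ * k)"] by (simp add: wind_def vec_eq_iff)

lemma wind_frac: "wind a (frac t) = wind a t"
proof -
  show ?thesis
    using wind_add[of a "frac t" "of_int \<lfloor>t\<rfloor>"] by (simp add: frac_def wind_int)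
qed

lemma compact_range_wind: "compact (range (wind a))"
proof -
  have "range (wind a) = wind a ` {0..1}"
  proof (intro equalityI subsetI)
    fix z assume "z \<in> range (wind a)"
    then obtain t where "z = wind a (frac t)" by (auto simp: wind_frac)
    then show "z \<in> wind a ` {0..1}" by (auto intro!: imageI simp: frac_lt_1 less_imp_le)
  qed auto
  then show ?thesis
    by (simp add: compact_continuous_image continuous_on_wind)
qed

lemma circle_invariant_prob:
  fixes a :: "'m::finite \<Rightarrow> int"
  shows "\<exists>\<mu>. invariant_prob_on (range (wind a)) \<mu>"
proof -
  define U where "U = density lborel (indicator {0..<1::real} :: real \<Rightarrow> ennreal)"
  have [measurable]: "wind a \<in> borel_measurable borel"
    by (intro borel_measurable_continuous_onI continuous_intros)
  have [measurable_cong]: "sets U = sets borel" by (simp add: U_def)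
  interpret U: prob_space U
    by (rule prob_spaceI) (simp add: U_def emeasure_density)
  have inv: "distr (distr U borel (wind a)) borel (\<lambda>z. wind a s * z) = distr U borel (wind a)" for s
  proof -
    have "emeasure (distr U borel (\<lambda>t. wind a (t + s))) A = emeasure (distr U borel (wind a)) A"
      if [measurable]: "A \<in> sets borel" for A
    proof -
      have em: "emeasure (distr U borel f) A = (\<integral>\<^sup>+t. indicator A (f t) * indicator {0..<1} t \<partial>lborel)"
        if [measurable]: "f \<in> borel_measurable borel" for f :: "real \<Rightarrow> complex ^ 'm"
      proof -
        have "emeasure (distr U borel f) A = emeasure U (f -` A)"
          by (simp add: emeasure_distr U_def)
        also have "\<dots> = (\<integral>\<^sup>+t. indicator {0..<1} t * indicator (f -` A) t \<partial>lborel)"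
          unfolding U_def using measurable_sets[of f borel borel A]
          by (intro emeasure_density) auto
        finally show ?thesis by (simp add: indicator_def ac_simps)
      qed
      show ?thesis
        using nn_integral_periodic[of "\<lambda>t. indicator A (wind a t)" s]
        by (simp add: em wind_add wind_1)
    qed
    then have "distr U borel (\<lambda>t. wind a (t + s)) = distr U borel (wind a)"
      by (intro measure_eqI) auto
    then show ?thesis
      by (subst distr_distr) (auto simp: comp_def wind_add ac_simps)
  qed
  have [measurable]: "range (wind a) \<in> sets borel"
    by (simp add: borel_compact compact_range_wind)
  have "invariant_prob_on (range (wind a)) (distr U borel (wind a))"
    unfolding invariant_prob_on_def using inv
    by (auto simp: U.prob_space_distr AE_distr_iff)
  then show ?thesis by blast
qed

text \<open>The image of the \<open>n\<close>-dimensional torus under the homomorphism with integer matrix \<open>a\<close>. Written as a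
product of circles, it grows by one circle at a time.\<close>

definition torus_image :: "nat \<Rightarrow> (nat \<Rightarrow> 'm \<Rightarrow> int) \<Rightarrow> (complex ^ 'm::finite) set" where
  "torus_image n a = range (\<lambda>x::nat \<Rightarrow> real. \<Prod>i<n. wind (a i) (x i))"

lemma torus_image_Suc:
  "torus_image (Suc n) a = (\<lambda>(x, y). x * y) ` (torus_image n a \<times> range (wind (a n)))"
proof (intro equalityI subsetI)
  fix z assume "z \<in> (\<lambda>(x, y). x * y) ` (torus_image n a \<times> range (wind (a n)))"
  then obtain x t where z: "z = (\<Prod>i<n. wind (a i) (x i)) * wind (a n) t"
    by (auto simp: torus_image_def)
  have "z = (\<Prod>i<Suc n. wind (a i) ((x(n := t)) i))"
    by (simp add: z)
  also have "\<dots> \<in> range (\<lambda>x. \<Prod>i<Suc n. wind (a i) (x i))"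
    by (rule rangeI)
  finally show "z \<in> torus_image (Suc n) a" unfolding torus_image_def .
qed (auto simp: torus_image_def)

lemma compact_torus_image: "compact (torus_image n a)"
proof (induction n)
  case 0
  then show ?case by (simp add: torus_image_def)
next
  case (Suc n)
  then show ?case
    unfolding torus_image_Suc case_prod_beta
    by (intro compact_continuous_image compact_Times compact_range_wind continuous_intros)
qed

lemma torus_image_invariant_prob: "\<exists>\<mu>. invariant_prob_on (torus_image n a) \<mu>"
proof (induction n)
  case 0
  have "distr (return borel 1) borel (\<lambda>z::complex ^ 'm. 1 * z) = return borel 1"
    by (subst distr_return) auto
  then have "invariant_prob_on {1 :: complex ^ 'm} (return borel 1)"
    by (simp add: invariant_prob_on_def prob_space_return AE_return)
  then show ?case by (auto simp: torus_image_def)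
next
  case (Suc n)
  obtain \<mu> \<nu> where "invariant_prob_on (torus_image n a) \<mu>" "invariant_prob_on (range (wind (a n))) \<nu>"
    using Suc circle_invariant_prob by blast
  from invariant_prob_on_product[OF this _ _ torus_image_Suc]
  show ?case by (blast intro: compact_imp_closed compact_torus_image compact_range_wind)
qed

text \<open>In an integer basis \<open>\<theta>\<close> of the frequencies (divided by \<open>2 * pi\<close>), the curve is the image of the line
with direction \<open>\<theta>\<close>. The image of the torus is compact, so it contains the closure of the curve.
Kronecker's theorem, applicable because the entries of \<open>\<theta>\<close> are independent over the integers, says
that the line is dense in the torus, which gives the other inclusion.\<close>

lemma torus_hull_eq_torus_image:
  fixes \<Gamma> :: "real ^ 'm::finite"
  shows "\<exists>n a. torus_hull \<Gamma> = torus_image n a"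
proof -
  obtain B where B: "finite B" "int_independent B" "\<And>j. int_combination B (\<Gamma> $ j / (2 * pi))"
    using exists_integer_basis[of "range (\<lambda>j. \<Gamma> $ j / (2 * pi))"] by auto
  obtain n \<theta> where n: "B = \<theta> ` {..<n}" and inj: "inj_on \<theta> {..<n::nat}"
    using finite_imp_nat_seg_image_inj_on[OF B(1)] by (auto simp: lessThan_def)
  obtain u :: "'m \<Rightarrow> real \<Rightarrow> int" where u: "\<And>j. \<Gamma> $ j / (2 * pi) = (\<Sum>v\<in>B. of_int (u j v) * v)"
    using B(3) unfolding int_combination_def by metis
  define a where "a i j = u j (\<theta> i)" for i j
  have \<Gamma>: "\<Gamma> $ j = 2 * pi * (\<Sum>i<n. of_int (a i j) * \<theta> i)" for j
    using u[of j] unfolding n a_def by (simp add: sum.reindex[OF inj] field_simps)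
  define \<Psi> where "\<Psi> x = (\<Prod>i<n. wind (a i) (x i))" for x
  have \<Psi>_nth: "\<Psi> x $ j = cis (2 * pi * (\<Sum>i<n. of_int (a i j) * x i))" for x j
  proof -
    have "(\<Prod>i<k. wind (a i) (x i)) $ j = cis (2 * pi * (\<Sum>i<k. of_int (a i j) * x i))" for k
      by (induction k) (auto simp: wind_def cis_mult algebra_simps)
    then show ?thesis by (simp add: \<Psi>_def)
  qed
  have curve: "torus_curve \<Gamma> y = \<Psi> (\<lambda>i. y * \<theta> i)" for y
    by (simp add: torus_curve_def vec_eq_iff \<Psi>_nth \<Gamma> cis_conv_exp sum_distrib_left sum_distrib_right mult_ac)
  have "torus_hull \<Gamma> \<subseteq> torus_image n a"
    unfolding torus_hull_def
    by (rule closure_minimal)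
       (auto simp: curve \<Psi>_def torus_image_def compact_imp_closed[OF compact_torus_image[unfolded torus_image_def]])
  moreover have "\<Psi> x \<in> torus_hull \<Gamma>" for x
  proof -
    interpret M: Modules.module "(\<lambda>r. (*) (real_of_int r))"
      by (simp add: Modules.module.intro distrib_left mult.commute)
    have indep: "M.independent (\<theta> ` {..<n})"
      using B(1,2) unfolding n[symmetric] int_independent_def
      by (auto simp: M.dependent_finite)
    have "\<exists>t h. \<forall>i<n. \<bar>t * \<theta> i - of_int (h i) - x i\<bar> < 1 / Suc k" for k
    proof -
      have "0 < 1 / real (Suc k)" by simp
      from Kronecker_thm_1[OF indep inj this, of x] show ?thesis by metis
    qed
    then obtain t h where th: "\<And>k i. i < n \<Longrightarrow> \<bar>t k * \<theta> i - of_int (h k i) - x i\<bar> < 1 / Suc k"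
      by metis
    have "(\<lambda>k. t k * \<theta> i - of_int (h k i)) \<longlonglongrightarrow> x i" if "i < n" for i
    proof (rule LIM_zero_cancel, rule Lim_null_comparison)
      show "\<forall>\<^sub>F k in sequentially. norm (t k * \<theta> i - of_int (h k i) - x i) \<le> 1 / Suc k"
        using th[OF that] by (auto intro!: always_eventually less_imp_le)
      show "(\<lambda>k. 1 / real (Suc k)) \<longlonglongrightarrow> 0"
        using LIMSEQ_inverse_real_of_nat by (simp add: inverse_eq_divide)
    qed
    then have "(\<lambda>k. \<Psi> (\<lambda>i. t k * \<theta> i - of_int (h k i))) \<longlonglongrightarrow> \<Psi> x"
      by (intro vec_tendstoI) (auto simp: \<Psi>_nth intro!: tendsto_intros)
    moreover have "\<Psi> (\<lambda>i. t k * \<theta> i - of_int (h k i)) = torus_curve \<Gamma> (t k)" for k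
    proof -
      have "wind (a i) (t k * \<theta> i - of_int (h k i)) = wind (a i) (t k * \<theta> i)" for i
        using wind_int[of "a i" "h k i"] wind_add[of "a i" "t k * \<theta> i - of_int (h k i)" "of_int (h k i)"] by simp
      then show ?thesis by (simp add: curve \<Psi>_def)
    qed
    ultimately show ?thesis
      unfolding torus_hull_def closure_sequential by (intro exI[of _ "\<lambda>k. torus_curve \<Gamma> (t k)"]) simp
  qed
  ultimately show ?thesis
    by (intro exI[of _ n] exI[of _ a]) (auto simp: torus_image_def \<Psi>_def)
qed

section \<open>The Haar measure\<close>

lemma torus_hull_mult_closed:
  assumes "x \<in> torus_hull \<Gamma>" "y \<in> torus_hull \<Gamma>" shows "x * y \<in> torus_hull \<Gamma>"
proof -
  obtain f g where f: "\<And>n. f n \<in> range (torus_curve \<Gamma>)" "f \<longlonglongrightarrow> x"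
    and g: "\<And>n. g n \<in> range (torus_curve \<Gamma>)" "g \<longlonglongrightarrow> y"
    using assms unfolding torus_hull_def closure_sequential by auto
  have "(\<lambda>n. f n * g n) \<longlonglongrightarrow> x * y"
    unfolding times_vec_def using f g by (intro tendsto_intros)
  moreover have "f n * g n \<in> range (torus_curve \<Gamma>)" for n
  proof -
    obtain s t where st: "f n = torus_curve \<Gamma> s" "g n = torus_curve \<Gamma> t" using f g by blast
    have "f n * g n = torus_curve \<Gamma> (s + t)"
      unfolding st by (simp add: torus_curve_def vec_eq_iff distrib_left exp_add)
    then show ?thesis by simp
  qed
  ultimately show ?thesis
    unfolding torus_hull_def closure_sequential by (intro exI[of _ "\<lambda>n. f n * g n"]) simp
qed

lemma compact_torus_hull: "compact (torus_hull \<Gamma>)"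
  using torus_hull_eq_torus_image[of \<Gamma>] compact_torus_image by metis

text \<open>By Fubini, \<open>\<mu>\<close> and \<open>\<nu>\<close> both equal their convolution: integrating the indicator of \<open>A\<close> at \<open>x * y\<close>
over \<open>y\<close> first gives \<open>\<nu> A\<close>, and over \<open>x\<close> first gives \<open>\<mu> A\<close>.\<close>

lemma haar_prob_unique:
  assumes \<mu>: "is_haar_prob G \<mu>" and \<nu>: "is_haar_prob G \<nu>"
    and closed: "\<And>x y. x \<in> G \<Longrightarrow> y \<in> G \<Longrightarrow> x * y \<in> G"
  shows "\<mu> = \<nu>"
proof -
  interpret \<mu>: prob_space \<mu> using \<mu> by (simp add: is_haar_prob_def)
  interpret \<nu>: prob_space \<nu> using \<nu> by (simp add: is_haar_prob_def)
  interpret P: pair_prob_space \<mu> \<nu> ..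
  have sets[measurable_cong]: "sets \<mu> = sets (restrict_space borel G)" "sets \<nu> = sets (restrict_space borel G)"
    using \<mu> \<nu> by (simp_all add: is_haar_prob_def)
  have space: "space \<mu> = G" "space \<nu> = G"
    using sets_eq_imp_space_eq[OF sets(1)] sets_eq_imp_space_eq[OF sets(2)] by (simp_all add: space_restrict_space)
  have [measurable]: "(\<lambda>z. z) \<in> measurable (restrict_space borel G) borel"
    by (simp add: measurable_restrict_space1)
  have id\<mu>: "(\<lambda>z. z) \<in> measurable \<mu> borel" and id\<nu>: "(\<lambda>z. z) \<in> measurable \<nu> borel" by measurable
  have mult[measurable]: "(\<lambda>(x, y). x * y) \<in> measurable (\<mu> \<Otimes>\<^sub>M \<nu>) (restrict_space borel G)"
  proof (rule measurable_restrict_space2)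
    show "(\<lambda>(x, y). x * y) \<in> space (\<mu> \<Otimes>\<^sub>M \<nu>) \<rightarrow> G"
      by (auto simp: space_pair_measure space closed)
    have "(\<lambda>p. fst p * snd p) \<in> borel_measurable (\<mu> \<Otimes>\<^sub>M \<nu>)"
      using measurable_compose[OF measurable_fst id\<mu>] measurable_compose[OF measurable_snd id\<nu>]
      by (intro borel_measurable_vec_times) auto
    then show "(\<lambda>(x, y). x * y) \<in> borel_measurable (\<mu> \<Otimes>\<^sub>M \<nu>)" by (simp add: case_prod_beta')
  qed
  have transl: "(\<integral>\<^sup>+y. indicator A (g * y) \<partial>\<rho>) = emeasure \<rho> A"
    if \<rho>: "is_haar_prob G \<rho>" and g: "g \<in> G" and A: "A \<in> sets (restrict_space borel G)" for \<rho> g A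
  proof -
    have s[measurable_cong]: "sets \<rho> = sets (restrict_space borel G)" using \<rho> by (simp add: is_haar_prob_def)
    have sp: "space \<rho> = G" using sets_eq_imp_space_eq[OF s] by (simp add: space_restrict_space)
    have id: "(\<lambda>z. z) \<in> measurable \<rho> borel" by measurable
    have m: "(\<lambda>z. g * z) \<in> measurable \<rho> (restrict_space borel G)"
      using closed g sp id by (intro measurable_restrict_space2) auto
    have "emeasure \<rho> A = emeasure (distr \<rho> \<rho> (\<lambda>z. g * z)) A"
      using \<rho> g by (simp add: is_haar_prob_def)
    also have "\<dots> = (\<integral>\<^sup>+z. indicator A z \<partial>distr \<rho> \<rho> (\<lambda>z. g * z))"
      using A s by simp
    also have "\<dots> = (\<integral>\<^sup>+y. indicator A (g * y) \<partial>\<rho>)"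
      using A s m by (intro nn_integral_distr) (auto cong: measurable_cong_sets)
    finally show ?thesis by simp
  qed
  show ?thesis
  proof (rule measure_eqI)
    show "sets \<mu> = sets \<nu>" by (simp add: sets)
    fix A assume "A \<in> sets \<mu>"
    then have A[measurable]: "A \<in> sets (restrict_space borel G)" by (simp add: sets)
    have "emeasure \<nu> A = (\<integral>\<^sup>+x. \<integral>\<^sup>+y. indicator A (x * y) \<partial>\<nu> \<partial>\<mu>)"
    proof -
      have "(\<integral>\<^sup>+x. \<integral>\<^sup>+y. indicator A (x * y) \<partial>\<nu> \<partial>\<mu>) = (\<integral>\<^sup>+x. emeasure \<nu> A \<partial>\<mu>)"
        using transl[OF \<nu> _ A] by (intro nn_integral_cong) (simp add: space)
      then show ?thesis by (simp add: \<mu>.emeasure_space_1)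
    qed
    also have "\<dots> = (\<integral>\<^sup>+y. \<integral>\<^sup>+x. indicator A (x * y) \<partial>\<mu> \<partial>\<nu>)"
      using measurable_compose[OF mult borel_measurable_indicator[OF A]]
      by (intro P.Fubini'[symmetric]) (simp add: case_prod_beta')
    also have "\<dots> = emeasure \<mu> A"
    proof -
      have "(\<integral>\<^sup>+y. \<integral>\<^sup>+x. indicator A (x * y) \<partial>\<mu> \<partial>\<nu>) = (\<integral>\<^sup>+y. emeasure \<mu> A \<partial>\<nu>)"
        using transl[OF \<mu> _ A] by (intro nn_integral_cong) (simp add: space mult.commute)
      then show ?thesis by (simp add: \<nu>.emeasure_space_1)
    qed
    finally show "emeasure \<mu> A = emeasure \<nu> A" by simp
  qed
qed

lemma haar_prob_exists: "\<exists>\<mu>. is_haar_prob (torus_hull \<Gamma>) \<mu>"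
proof -
  define G where "G = torus_hull \<Gamma>"
  obtain \<mu> where \<mu>: "invariant_prob_on G \<mu>"
    unfolding G_def using torus_hull_eq_torus_image[of \<Gamma>] torus_image_invariant_prob by metis
  have G[measurable]: "G \<in> sets borel"
    by (simp add: G_def compact_torus_hull borel_compact)
  have s[measurable_cong]: "sets \<mu> = sets borel" and ae: "AE z in \<mu>. z \<in> G"
    and inv: "\<And>g. g \<in> G \<Longrightarrow> distr \<mu> borel (\<lambda>z. g * z) = \<mu>"
    using \<mu> by (auto simp: invariant_prob_on_def)
  have sp: "space \<mu> = UNIV" using sets_eq_imp_space_eq[OF s] by simp
  interpret prob_space \<mu> using \<mu> by (simp add: invariant_prob_on_def)
  define \<nu> where "\<nu> = restrict_space \<mu> G"
  have sn[measurable_cong]: "sets \<nu> = sets (restrict_space borel G)"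
    unfolding \<nu>_def by (intro sets_restrict_space_cong s)
  have spn: "space \<nu> = G" by (simp add: \<nu>_def space_restrict_space sp)
  have full: "emeasure \<mu> G = 1"
    using ae by (subst emeasure_eq_1_AE) auto
  have "prob_space \<nu>"
    by (rule prob_spaceI) (simp add: \<nu>_def emeasure_restrict_space space_restrict_space sp full)
  moreover have "distr \<nu> \<nu> (\<lambda>z. g * z) = \<nu>" if g: "g \<in> G" for g
  proof (rule measure_eqI)
    fix A assume "A \<in> sets (distr \<nu> \<nu> (\<lambda>z. g * z))"
    then have A: "A \<in> sets borel" "A \<subseteq> G"
      using G by (auto simp: sn sets_restrict_space_iff)
    have Av: "A \<in> sets \<nu>" using A by (simp add: sn sets_restrict_space_iff)
    have [measurable]: "A \<in> sets borel" by fact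
    have "(\<lambda>z. z) \<in> measurable \<nu> borel" by (simp add: \<nu>_def measurable_restrict_space1)
    then have m: "(\<lambda>z. g * z) \<in> measurable \<nu> (restrict_space borel G)"
      using g spn torus_hull_mult_closed[of _ \<Gamma>, folded G_def] by (intro measurable_restrict_space2) auto
    then have m': "(\<lambda>z. g * z) \<in> measurable \<nu> \<nu>" by (simp cong: measurable_cong_sets add: sn)
    have "emeasure (distr \<nu> \<nu> (\<lambda>z. g * z)) A = emeasure \<nu> ((\<lambda>z. g * z) -` A \<inter> G)"
      using m' Av by (simp add: emeasure_distr spn)
    also have "\<dots> = emeasure \<mu> ((\<lambda>z. g * z) -` A \<inter> G)"
      unfolding \<nu>_def by (rule emeasure_restrict_space) (auto simp: sp)
    also have "\<dots> = emeasure \<mu> ((\<lambda>z. g * z) -` A \<inter> space \<mu>)"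
    proof (rule emeasure_eq_AE)
      have "(\<lambda>z. g * z) -` A \<inter> space \<mu> \<in> sets \<mu>"
        by (rule measurable_sets[of _ _ borel]) auto
      then show "(\<lambda>z. g * z) -` A \<inter> space \<mu> \<in> sets \<mu>" "(\<lambda>z. g * z) -` A \<inter> G \<in> sets \<mu>"
        by (auto simp: sp s)
    qed (use ae in \<open>auto simp: sp\<close>)
    also have "\<dots> = emeasure (distr \<mu> borel (\<lambda>z. g * z)) A"
      by (simp add: emeasure_distr)
    also have "\<dots> = emeasure \<mu> A" by (simp add: inv[OF g])
    also have "\<dots> = emeasure \<nu> A"
      unfolding \<nu>_def using A by (intro emeasure_restrict_space[symmetric]) (auto simp: sp)
    finally show "emeasure (distr \<nu> \<nu> (\<lambda>z. g * z)) A = emeasure \<nu> A" .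
  qed simp
  ultimately have "is_haar_prob G \<nu>" by (simp add: is_haar_prob_def sn)
  then show ?thesis by (auto simp: G_def)
qed

lemma is_haar_prob_haar_prob: "is_haar_prob (torus_hull \<Gamma>) (haar_prob (torus_hull \<Gamma>))"
proof -
  obtain \<mu> where \<mu>: "is_haar_prob (torus_hull \<Gamma>) \<mu>"
    using haar_prob_exists by blast
  show ?thesis
    unfolding haar_prob_def
    by (rule theI[where a = \<mu>], rule \<mu>) (rule haar_prob_unique[OF _ \<mu> torus_hull_mult_closed])
qed

section \<open>Exponential averages along the curve\<close>

text \<open>The law of \<open>exp u\<close> for an exponentially distributed \<open>u\<close> of rate \<open>\<delta>\<close>. Its density is \<open>\<delta>\<close> times the weight of
a Mellin integral at abscissa \<open>\<delta>\<close>, so that averages against it compute limits of \<open>\<delta>\<close> times a Mellin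
transform; small \<open>\<delta>\<close> spreads the mass over longer and longer ranges.\<close>

definition pareto_density :: "real \<Rightarrow> real \<Rightarrow> real" where
  "pareto_density \<delta> x = indicator {1..} x * (\<delta> * x powr (- \<delta> - 1))"

definition pareto :: "real \<Rightarrow> real measure" where
  "pareto \<delta> = density lborel (\<lambda>x. ennreal (pareto_density \<delta> x))"

lemma pareto_density_measurable [measurable]: "pareto_density \<delta> \<in> borel_measurable borel"
  unfolding pareto_density_def by measurable

lemma sets_pareto [simp, measurable_cong]: "sets (pareto \<delta>) = sets borel"
  by (simp add: pareto_def)

lemma space_pareto [simp]: "space (pareto \<delta>) = UNIV"
  by (simp add: pareto_def)

lemma pareto_density_nonneg: "\<delta> > 0 \<Longrightarrow> pareto_density \<delta> x \<ge> 0"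
  by (simp add: pareto_density_def)

lemma nn_integral_pareto_density:
  assumes "\<delta> > 0"
  shows "(\<integral>\<^sup>+x. ennreal (pareto_density \<delta> x) \<partial>lborel) = 1"
proof -
  have "(\<integral>\<^sup>+x. ennreal (\<delta> * x powr (- \<delta> - 1)) * indicator {1..} x \<partial>lborel) = ennreal (0 - (- (1 powr (- \<delta>))))"
  proof (rule nn_integral_FTC_atLeast)
    show "((\<lambda>x. - (x powr - \<delta>)) has_real_derivative \<delta> * x powr (- \<delta> - 1)) (at x)" if "1 \<le> x" for x
      using that by (auto intro!: derivative_eq_intros simp: powr_diff)
    show "((\<lambda>x. - (x powr - \<delta>)) \<longlongrightarrow> 0) at_top"
      using tendsto_minus[OF tendsto_neg_powr[OF _ filterlim_ident, of "- \<delta>"]] assms by simp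
  qed (use assms in auto)
  also have "(\<integral>\<^sup>+x. ennreal (\<delta> * x powr (- \<delta> - 1)) * indicator {1..} x \<partial>lborel)
      = (\<integral>\<^sup>+x. ennreal (pareto_density \<delta> x) \<partial>lborel)"
    by (intro nn_integral_cong) (auto simp: pareto_density_def split: split_indicator)
  finally show ?thesis by simp
qed

lemma prob_space_pareto: "\<delta> > 0 \<Longrightarrow> prob_space (pareto \<delta>)"
  by (rule prob_spaceI) (simp add: pareto_def emeasure_density nn_integral_pareto_density)

lemma pareto_density_integral:
  assumes "\<delta> > 0"
  shows "has_bochner_integral lborel (pareto_density \<delta>) 1"
  using nn_integral_pareto_density[OF assms] assms
  by (intro has_bochner_integral_nn_integral) (auto simp: pareto_density_nonneg)

lemma integral_pareto:
  fixes g :: "real \<Rightarrow> 'b::{banach, second_countable_topology}"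
  assumes "\<delta> > 0" "g \<in> borel_measurable borel"
  shows "(LINT x|pareto \<delta>. g x) = (LINT x|lborel. pareto_density \<delta> x *\<^sub>R g x)"
  unfolding pareto_def using assms by (intro integral_density) (auto simp: pareto_density_nonneg)

lemma AE_pareto: "\<delta> > 0 \<Longrightarrow> AE x in pareto \<delta>. x \<ge> 1"
  unfolding pareto_def by (subst AE_density) (auto simp: pareto_density_def split: split_indicator)

text \<open>The dilated measure has density \<open>k' v = k (v / a) / a\<close>. It vanishes on \<open>[1, a)\<close> and is \<open>a powr \<delta> * k v\<close>
beyond, so the total variation distance of the two probability densities is \<open>2 * (1 - a powr (- \<delta>))\<close>.\<close>

lemma pareto_dilation_ge_1:
  fixes g :: "real \<Rightarrow> real"
  assumes \<delta>: "\<delta> > 0" and a: "a \<ge> 1" and [measurable]: "g \<in> borel_measurable borel"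
    and B: "\<And>x. \<bar>g x\<bar> \<le> B"
  shows "\<bar>(LINT x|pareto \<delta>. g (a * x)) - (LINT x|pareto \<delta>. g x)\<bar> \<le> 2 * B * (1 - a powr (- \<delta>))"
proof -
  define k where "k = pareto_density \<delta>"
  define k' where "k' v = k (v / a) / a" for v
  have [measurable]: "k \<in> borel_measurable borel" "k' \<in> borel_measurable borel"
    unfolding k_def k'_def[abs_def] by measurable
  have k: "has_bochner_integral lborel k 1"
    unfolding k_def by (rule pareto_density_integral[OF \<delta>])
  have scale: "(LINT v|lborel. f (v / a) / a) = (LINT x|lborel. f x)" for f :: "real \<Rightarrow> real"
    using lborel_integral_real_affine[of "1/a" f 0] a by simp
  have "integrable lborel (\<lambda>v. k (0 + (1 / a) * v))"
    using k a by (intro lborel_integrable_real_affine) (auto simp: has_bochner_integral_iff)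
  then have k': "has_bochner_integral lborel k' 1"
    using k scale[of k] a by (auto simp: has_bochner_integral_iff k'_def[abs_def])
  have k0: "0 \<le> k v" "0 \<le> k' v" for v
    using \<delta> a by (auto simp: k_def k'_def pareto_density_nonneg)
  \<comment> \<open>The right-hand side is \<open>\<bar>k' v - k v\<bar>\<close> itself, in a form that is linear in the two densities.\<close>
  have pt: "\<bar>k' v - k v\<bar> \<le> k v + (1 - 2 * a powr (- \<delta>)) * k' v" for v
  proof (cases "v < a")
    case True
    then have "k' v = 0" using a by (auto simp: k'_def k_def pareto_density_def field_simps)
    then show ?thesis using k0 by simp
  next
    case False
    then have v: "v \<ge> a" "v > 0" "v \<ge> 1" using a by auto
    have "k' v = \<delta> * (v / a) powr (- \<delta> - 1) / a"
      using v a by (simp add: k'_def k_def pareto_density_def)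
    also have "\<dots> = a powr \<delta> * (\<delta> * v powr (- \<delta> - 1))"
      using v a by (simp add: powr_divide powr_diff powr_minus field_simps)
    also have "\<dots> = a powr \<delta> * k v" using v by (simp add: k_def pareto_density_def)
    finally have "k v = a powr (- \<delta>) * k' v" using a by (simp add: powr_minus)
    moreover have "a powr (- \<delta>) \<le> 1" using powr_mono[of "- \<delta>" 0 a] a \<delta> by simp
    ultimately have "k v \<le> k' v" using k0(2)[of v] by (simp add: mult_left_le_one_le)
    then show ?thesis using \<open>k v = _\<close> by (simp add: algebra_simps)
  qed
  have int: "integrable lborel (\<lambda>v. h v * g v)" if "has_bochner_integral lborel h 1" for h
  proof (rule Bochner_Integration.integrable_bound)
    show "integrable lborel (\<lambda>v. B * h v)" using that by (auto simp: has_bochner_integral_iff)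
    show "AE x in lborel. norm (h x * g x) \<le> norm (B * h x)"
      using order_trans[OF B abs_ge_self]
      by (intro AE_I2) (simp add: abs_mult mult.commute[of "\<bar>B\<bar>"] mult_left_mono)
  qed (use that in \<open>auto simp: has_bochner_integral_iff\<close>)
  have "(LINT x|pareto \<delta>. g (a * x)) = (LINT x|lborel. k x * g (a * x))"
    by (subst integral_pareto[OF \<delta>]) (auto simp: k_def)
  also have "\<dots> = (LINT v|lborel. k' v * g v)"
    using scale[of "\<lambda>x. k x * g (a * x)"] a by (simp add: k'_def)
  finally have 1: "(LINT x|pareto \<delta>. g (a * x)) = (LINT v|lborel. k' v * g v)" .
  have 2: "(LINT x|pareto \<delta>. g x) = (LINT v|lborel. k v * g v)"
    by (subst integral_pareto[OF \<delta>]) (auto simp: k_def)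
  have "(LINT x|pareto \<delta>. g (a * x)) - (LINT x|pareto \<delta>. g x) = (LINT v|lborel. (k' v - k v) * g v)"
    unfolding 1 2 using int[OF k] int[OF k'] by (simp add: left_diff_distrib)
  also have "\<bar>\<dots>\<bar> \<le> (LINT v|lborel. B * (k v + (1 - 2 * a powr (- \<delta>)) * k' v))"
  proof (rule order_trans[OF integral_abs_bound integral_mono])
    show "integrable lborel (\<lambda>v. \<bar>(k' v - k v) * g v\<bar>)"
      using int[OF k] int[OF k'] by (intro integrable_abs) (simp add: left_diff_distrib)
    show "integrable lborel (\<lambda>v. B * (k v + (1 - 2 * a powr (- \<delta>)) * k' v))"
      using k k' by (auto simp: has_bochner_integral_iff)
    show "\<bar>(k' v - k v) * g v\<bar> \<le> B * (k v + (1 - 2 * a powr (- \<delta>)) * k' v)" for v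
      using mult_mono[OF pt[of v] B[of v]] order_trans[OF abs_ge_zero pt[of v]]
      by (simp add: abs_mult mult.commute)
  qed
  also have "\<dots> = 2 * B * (1 - a powr (- \<delta>))"
    using k k' by (simp add: has_bochner_integral_iff)
  finally show ?thesis .
qed

text \<open>A contraction is undone by a dilation, so the case \<open>y < 0\<close> is the case \<open>y > 0\<close> for a dilated function.
The bound tends to \<open>0\<close> with \<open>\<delta>\<close>: on the logarithmic scale the averages are asymptotically invariant
under translation.\<close>

lemma pareto_dilation:
  fixes g :: "real \<Rightarrow> real"
  assumes \<delta>: "\<delta> > 0" and [measurable]: "g \<in> borel_measurable borel" and B: "\<And>x. \<bar>g x\<bar> \<le> B"
  shows "\<bar>(LINT x|pareto \<delta>. g (exp y * x)) - (LINT x|pareto \<delta>. g x)\<bar> \<le> 2 * B * (1 - exp (- \<delta> * \<bar>y\<bar>))"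
proof (cases "y \<ge> 0")
  case True
  then show ?thesis
    using pareto_dilation_ge_1[OF \<delta> _ assms(2) B, of "exp y"] by (simp add: powr_def)
next
  case False
  have cancel: "exp y * (exp (-y) * x) = x" for x
    by (simp add: mult.assoc[symmetric] exp_add[symmetric])
  have *: "\<bar>(LINT x|pareto \<delta>. g (exp y * (exp (- y) * x))) - (LINT x|pareto \<delta>. g (exp y * x))\<bar>
      \<le> 2 * B * (1 - exp (- y) powr (- \<delta>))"
    by (rule pareto_dilation_ge_1[OF \<delta>]) (use False B in auto)
  have **: "exp (- y) powr (- \<delta>) = exp (- \<delta> * \<bar>y\<bar>)"
    using False by (simp add: powr_def)
  show ?thesis
    using *[unfolded cancel **] by linarith
qed

lemma torus_curve_add: "torus_curve \<Gamma> (s + t) = torus_curve \<Gamma> s * torus_curve \<Gamma> t"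
  by (simp add: torus_curve_def vec_eq_iff distrib_left exp_add)

lemma torus_curve_in_hull: "torus_curve \<Gamma> y \<in> torus_hull \<Gamma>"
  unfolding torus_hull_def by (rule subsetD[OF closure_subset]) simp

lemma torus_curve_measurable [measurable]: "torus_curve \<Gamma> \<in> borel_measurable borel"
  unfolding torus_curve_def by (intro borel_measurable_continuous_onI continuous_intros)

locale torus_haar =
  fixes \<Gamma> :: "real ^ 'm::finite" and \<mu> :: "(complex ^ 'm) measure"
  assumes haar: "is_haar_prob (torus_hull \<Gamma>) \<mu>"
begin

sublocale prob_space \<mu>
  using haar by (simp add: is_haar_prob_def)

lemma sets_haar [measurable_cong]: "sets \<mu> = sets (restrict_space borel (torus_hull \<Gamma>))"
  using haar by (simp add: is_haar_prob_def)

lemma space_haar: "space \<mu> = torus_hull \<Gamma>"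
  using sets_eq_imp_space_eq[OF sets_haar] by (simp add: space_restrict_space)

lemma measurable_haar [measurable (raw)]: "g \<in> borel_measurable borel \<Longrightarrow> g \<in> borel_measurable \<mu>"
  by (subst measurable_cong_sets[OF sets_haar refl]) (rule measurable_restrict_space1)

lemma integral_translate:
  fixes h :: "complex ^ 'm \<Rightarrow> 'b::{banach, second_countable_topology}"
  assumes h: "h \<in> borel_measurable borel" and w: "w \<in> torus_hull \<Gamma>"
  shows "(LINT z|\<mu>. h (w * z)) = (LINT z|\<mu>. h z)"
proof -
  have "(\<lambda>z. w * z) \<in> measurable \<mu> (restrict_space borel (torus_hull \<Gamma>))"
    using w torus_hull_mult_closed by (intro measurable_restrict_space2) (auto simp: space_haar)
  then have m: "(\<lambda>z. w * z) \<in> measurable \<mu> \<mu>" by (simp cong: measurable_cong_sets add: sets_haar)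
  have "(LINT z|\<mu>. h z) = (LINT z|distr \<mu> \<mu> (\<lambda>z. w * z). h z)"
    using haar w by (simp add: is_haar_prob_def)
  also have "\<dots> = (LINT z|\<mu>. h (w * z))"
    using m measurable_haar[OF h] by (intro integral_distr)
  finally show ?thesis by simp
qed

lemma bounded_on_hull:
  fixes g :: "complex ^ 'm \<Rightarrow> 'b::real_normed_vector"
  assumes "continuous_on UNIV g"
  obtains B where "\<And>z. z \<in> torus_hull \<Gamma> \<Longrightarrow> norm (g z) \<le> B"
proof -
  have "bounded (g ` torus_hull \<Gamma>)"
    using continuous_on_subset[OF assms] compact_torus_hull
    by (intro compact_imp_bounded compact_continuous_image) auto
  then show ?thesis using that by (auto simp: bounded_iff)
qed

lemma integrable_continuous:
  fixes g :: "complex ^ 'm \<Rightarrow> 'b::{banach, second_countable_topology}"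
  assumes "continuous_on UNIV g" shows "integrable \<mu> g"
proof -
  obtain B where "\<And>z. z \<in> torus_hull \<Gamma> \<Longrightarrow> norm (g z) \<le> B"
    using bounded_on_hull[OF assms] by blast
  then show ?thesis
    using assms by (intro integrable_const_bound[where B = B] AE_I2)
      (auto simp: space_haar intro!: measurable_haar borel_measurable_continuous_onI)
qed

text \<open>For a fixed point of the curve this is the asymptotic invariance under dilations. By uniform continuity
the average changes by little when \<open>w\<close> moves by little, and by compactness finitely many points of the
curve come close to every \<open>w\<close>.\<close>

lemma uniform_translation_average:
  fixes g :: "complex ^ 'm \<Rightarrow> real"
  assumes g: "continuous_on UNIV g" and e: "e > 0"
  shows "\<forall>\<^sub>F \<delta> in at_right 0. \<forall>w\<in>torus_hull \<Gamma>.
    \<bar>(LINT x|pareto \<delta>. g (w * torus_curve \<Gamma> (ln x))) - (LINT x|pareto \<delta>. g (torus_curve \<Gamma> (ln x)))\<bar> \<le> e"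
proof -
  let ?G = "torus_hull \<Gamma>"
  have [measurable]: "g \<in> borel_measurable borel" by (rule borel_measurable_continuous_onI[OF g])
  obtain B where B: "\<And>z. z \<in> ?G \<Longrightarrow> \<bar>g z\<bar> \<le> B"
    using bounded_on_hull[OF g] by auto
  have "uniformly_continuous_on (?G \<times> ?G) (\<lambda>p. g (fst p * snd p))"
    using g by (intro compact_uniformly_continuous compact_Times compact_torus_hull
        continuous_on_compose2[OF g] continuous_intros) auto
  then obtain d where d: "d > 0" and
    d': "\<And>p q. p \<in> ?G \<times> ?G \<Longrightarrow> q \<in> ?G \<times> ?G \<Longrightarrow> dist q p < d \<Longrightarrow> \<bar>g (fst q * snd q) - g (fst p * snd p)\<bar> < e / 2"
    unfolding uniformly_continuous_on_def dist_real_def using e by (metis half_gt_zero)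
  have uc: "\<bar>g (w * z) - g (w' * z)\<bar> < e / 2" if "w \<in> ?G" "w' \<in> ?G" "z \<in> ?G" "dist w w' < d" for w w' z
    using d'[of "(w', z)" "(w, z)"] that by (simp add: dist_Pair_Pair)
  have "?G \<subseteq> (\<Union>y. ball (torus_curve \<Gamma> y) d)"
    using d unfolding torus_hull_def closure_approachable subset_iff by fastforce
  then obtain Y where Y: "finite Y" "?G \<subseteq> (\<Union>y\<in>Y. ball (torus_curve \<Gamma> y) d)"
    using compactE_image[OF compact_torus_hull[of \<Gamma>], of UNIV "\<lambda>y. ball (torus_curve \<Gamma> y) d"] by auto
  have "\<forall>\<^sub>F \<delta> in at_right 0. 2 * B * (1 - exp (- \<delta> * \<bar>y\<bar>)) < e / 2" for y
  proof (rule order_tendstoD(2))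
    show "((\<lambda>\<delta>. 2 * B * (1 - exp (- \<delta> * \<bar>y\<bar>))) \<longlongrightarrow> 2 * B * (1 - exp (- 0 * \<bar>y\<bar>))) (at_right 0)"
      by (intro tendsto_intros)
  qed (use e in simp)
  then have "\<forall>\<^sub>F \<delta> in at_right 0. \<forall>y\<in>Y. 2 * B * (1 - exp (- \<delta> * \<bar>y\<bar>)) < e / 2"
    using Y(1) by (simp add: eventually_ball_finite)
  with eventually_at_right_less[of 0] show ?thesis
  proof eventually_elim
    case (elim \<delta>)
    interpret P: prob_space "pareto \<delta>" using elim by (simp add: prob_space_pareto)
    let ?W = "\<lambda>w. LINT x|pareto \<delta>. g (w * torus_curve \<Gamma> (ln x))"
    have int: "integrable (pareto \<delta>) (\<lambda>x. g (w * torus_curve \<Gamma> (ln x)))" if "w \<in> ?G" for w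
      by (rule P.integrable_const_bound[where B = B])
         (auto intro!: AE_I2 B torus_hull_mult_closed torus_curve_in_hull that)
    show ?case
    proof
      fix w assume w: "w \<in> ?G"
      then obtain y where y: "y \<in> Y" "dist w (torus_curve \<Gamma> y) < d"
        using Y(2) by (auto simp: dist_commute)
      have "\<bar>?W w - ?W (torus_curve \<Gamma> y)\<bar> \<le> e / 2"
      proof -
        have "\<bar>?W w - ?W (torus_curve \<Gamma> y)\<bar>
            = \<bar>LINT x|pareto \<delta>. g (w * torus_curve \<Gamma> (ln x)) - g (torus_curve \<Gamma> y * torus_curve \<Gamma> (ln x))\<bar>"
          by (subst Bochner_Integration.integral_diff) (auto intro!: int w torus_curve_in_hull)
        also have "\<dots> \<le> (LINT x|pareto \<delta>. e / 2)"
        proof (rule order_trans[OF integral_abs_bound integral_mono])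
          show "integrable (pareto \<delta>)
              (\<lambda>x. \<bar>g (w * torus_curve \<Gamma> (ln x)) - g (torus_curve \<Gamma> y * torus_curve \<Gamma> (ln x))\<bar>)"
            by (intro integrable_abs Bochner_Integration.integrable_diff int w torus_curve_in_hull)
        qed (use uc[OF w torus_curve_in_hull torus_curve_in_hull y(2)] in \<open>auto intro: less_imp_le\<close>)
        finally show ?thesis using P.prob_space by simp
      qed
      moreover have "?W (torus_curve \<Gamma> y) = (LINT x|pareto \<delta>. g (torus_curve \<Gamma> (ln (exp y * x))))"
      proof (rule integral_cong_AE)
        show "AE x in pareto \<delta>. g (torus_curve \<Gamma> y * torus_curve \<Gamma> (ln x)) = g (torus_curve \<Gamma> (ln (exp y * x)))"
          using AE_pareto[OF elim(1)]
          by eventually_elim (simp add: torus_curve_add[symmetric] ln_mult)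
      qed auto
      moreover have "\<bar>(LINT x|pareto \<delta>. g (torus_curve \<Gamma> (ln (exp y * x)))) - (LINT x|pareto \<delta>. g (torus_curve \<Gamma> (ln x)))\<bar> \<le> e / 2"
        using elim y(1) pareto_dilation[OF elim(1), of "\<lambda>x. g (torus_curve \<Gamma> (ln x))" B y]
        by (force intro!: B torus_curve_in_hull)
      ultimately show "\<bar>?W w - (LINT x|pareto \<delta>. g (torus_curve \<Gamma> (ln x)))\<bar> \<le> e" by linarith
    qed
  qed
qed

text \<open>By invariance of the Haar measure, the average along the curve translated by \<open>w\<close>, averaged over \<open>w\<close>,
is exactly the space mean, for every \<open>\<delta>\<close>. For small \<open>\<delta>\<close> the average hardly depends on \<open>w\<close>, so the
untranslated curve already has nearly this average.\<close>

theorem equidistribution: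
  fixes g :: "complex ^ 'm \<Rightarrow> real"
  assumes g: "continuous_on UNIV g"
  shows "((\<lambda>\<delta>. LINT x|pareto \<delta>. g (torus_curve \<Gamma> (ln x))) \<longlongrightarrow> (LINT z|\<mu>. g z)) (at_right 0)"
proof (rule tendstoI)
  fix e :: real assume e: "e > 0"
  let ?G = "torus_hull \<Gamma>"
  have [measurable]: "g \<in> borel_measurable borel" by (rule borel_measurable_continuous_onI[OF g])
  obtain B where B: "\<And>z. z \<in> ?G \<Longrightarrow> \<bar>g z\<bar> \<le> B"
    using bounded_on_hull[OF g] by auto
  have "e / 2 > 0" using e by simp
  from uniform_translation_average[OF g this] eventually_at_right_less[of 0]
  show "\<forall>\<^sub>F \<delta> in at_right 0. dist (LINT x|pareto \<delta>. g (torus_curve \<Gamma> (ln x))) (LINT z|\<mu>. g z) < e"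
  proof eventually_elim
    case (elim \<delta>)
    interpret P: prob_space "pareto \<delta>" using elim by (simp add: prob_space_pareto)
    interpret PP: pair_prob_space \<mu> "pareto \<delta>" ..
    let ?F = "\<lambda>w x. g (w * torus_curve \<Gamma> (ln x))"
    have [measurable]: "(\<lambda>p. ?F (fst p) (snd p)) \<in> borel_measurable (\<mu> \<Otimes>\<^sub>M pareto \<delta>)"
    proof -
      have "fst \<in> borel_measurable (\<mu> \<Otimes>\<^sub>M pareto \<delta>)"
        by (rule measurable_compose[OF measurable_fst measurable_haar[OF measurable_ident_sets[OF refl]], unfolded comp_def])
      then show ?thesis by measurable
    qed
    have bnd: "\<bar>?F w x\<bar> \<le> B" if "w \<in> ?G" for w x
      by (intro B torus_hull_mult_closed torus_curve_in_hull that)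
    have int: "integrable (\<mu> \<Otimes>\<^sub>M pareto \<delta>) (\<lambda>(w, x). ?F w x)"
      by (rule PP.integrable_const_bound[where B = B])
         (auto intro!: AE_I2 bnd simp: space_pair_measure space_haar case_prod_beta')
    have "(LINT w|\<mu>. LINT x|pareto \<delta>. ?F w x) = (LINT x|pareto \<delta>. LINT w|\<mu>. ?F w x)"
      using PP.Fubini_integral[OF int] by simp
    also have "\<dots> = (LINT x|pareto \<delta>. LINT z|\<mu>. g z)"
      by (rule Bochner_Integration.integral_cong[OF refl])
         (simp add: mult.commute[of _ "torus_curve \<Gamma> _"] integral_translate torus_curve_in_hull)
    also have "\<dots> = (LINT z|\<mu>. g z)" using P.prob_space by simp
    finally have eq: "(LINT z|\<mu>. g z) = (LINT w|\<mu>. LINT x|pareto \<delta>. ?F w x)" by simp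
    let ?c = "LINT x|pareto \<delta>. g (torus_curve \<Gamma> (ln x))"
    have intW: "integrable \<mu> (\<lambda>w. LINT x|pareto \<delta>. ?F w x)"
      using PP.integrable_fst[OF int] by simp
    have "\<bar>(LINT z|\<mu>. g z) - ?c\<bar> = \<bar>LINT w|\<mu>. (LINT x|pareto \<delta>. ?F w x) - ?c\<bar>"
      unfolding eq using intW prob_space by simp
    also have "\<dots> \<le> (LINT w|\<mu>. e / 2)"
      using intW elim by (intro order_trans[OF integral_abs_bound integral_mono]) (auto simp: space_haar)
    also have "\<dots> < e" using e prob_space by simp
    finally show ?case by (simp add: dist_real_def abs_minus_commute)
  qed
qed

end

section \<open>Fourier coefficients and duality\<close>

lemma torus_curve_nth: "torus_curve \<Gamma> y $ j = cis (\<Gamma> $ j * y)"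
  by (simp add: torus_curve_def cis_conv_exp)

definition trig :: "complex ^ 'm::finite \<Rightarrow> complex ^ 'm \<Rightarrow> complex" where
  "trig a z = (\<Sum>j\<in>UNIV. a $ j * z $ j)"

lemma continuous_trig [continuous_intros]: "continuous_on S (trig a)"
  unfolding trig_def by (intro continuous_intros)

lemma trig_measurable [measurable]: "trig a \<in> borel_measurable borel"
  by (intro borel_measurable_continuous_onI continuous_intros)

locale torus_haar_distinct = torus_haar \<Gamma> \<mu>
  for \<Gamma> :: "real ^ 'm::finite" and \<mu> +
  assumes distinct: "i \<noteq> j \<Longrightarrow> \<Gamma> $ i \<noteq> \<Gamma> $ j"
begin

lemma norm_hull_nth: "z \<in> torus_hull \<Gamma> \<Longrightarrow> cmod (z $ j) = 1"
proof -
  assume z: "z \<in> torus_hull \<Gamma>"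
  have "closed {z::complex ^ 'm. cmod (z $ j) = 1}"
    by (intro closed_Collect_eq continuous_intros)
  moreover have "range (torus_curve \<Gamma>) \<subseteq> {z. cmod (z $ j) = 1}"
    by (auto simp: torus_curve_def)
  ultimately have "torus_hull \<Gamma> \<subseteq> {z. cmod (z $ j) = 1}"
    unfolding torus_hull_def by (intro closure_minimal)
  with z show ?thesis by blast
qed

text \<open>If \<open>i \<noteq> j\<close>, the character \<open>z $ i * cnj (z $ j)\<close> takes the value \<open>-1\<close> at some point of the curve, because
the two frequencies differ; translating by that point changes the sign of its integral.\<close>

lemma characters_orthonormal: "(LINT z|\<mu>. z $ i * cnj (z $ j)) = (if i = j then 1 else 0)"
proof (cases "i = j")
  case True
  have "(LINT z|\<mu>. z $ i * cnj (z $ j)) = (LINT z|\<mu>. 1)"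
    using norm_hull_nth True
    by (intro Bochner_Integration.integral_cong refl) (simp add: space_haar complex_norm_square[symmetric])
  then show ?thesis using True prob_space by simp
next
  case False
  define l where "l = \<Gamma> $ i - \<Gamma> $ j"
  have l: "l \<noteq> 0" using distinct[OF False] by (simp add: l_def)
  \<comment> \<open>Here the character, which is \<open>cis (l * y)\<close> on the curve, equals \<open>-1\<close>.\<close>
  define w where "w = torus_curve \<Gamma> (pi / l)"
  have w: "w $ i * cnj (w $ j) = -1"
  proof -
    have "w $ i * cnj (w $ j) = cis (\<Gamma> $ i * (pi / l) - \<Gamma> $ j * (pi / l))"
      by (simp only: w_def torus_curve_nth cis_cnj cis_mult) simp
    also have "\<Gamma> $ i * (pi / l) - \<Gamma> $ j * (pi / l) = l * (pi / l)"
      by (simp only: l_def left_diff_distrib)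
    also have "\<dots> = pi" using l by simp
    finally show ?thesis by simp
  qed
  let ?h = "\<lambda>z::complex ^ 'm. z $ i * cnj (z $ j)"
  have "(LINT z|\<mu>. ?h z) = (LINT z|\<mu>. ?h (w * z))"
    by (intro integral_translate[symmetric] borel_measurable_continuous_onI continuous_intros)
       (auto simp: w_def torus_curve_in_hull)
  also have "\<dots> = (LINT z|\<mu>. - ?h z)"
  proof (intro Bochner_Integration.integral_cong refl)
    fix z
    have "?h (w * z) = (w $ i * cnj (w $ j)) * ?h z" by (simp add: mult_ac)
    then show "?h (w * z) = - ?h z" by (simp add: w)
  qed
  finally have "(LINT z|\<mu>. ?h z) = - (LINT z|\<mu>. ?h z)" by simp
  then show ?thesis using False by simp
qed

definition coeffs :: "(complex ^ 'm \<Rightarrow> complex) \<Rightarrow> complex ^ 'm" where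
  "coeffs f = (\<chi> j. LINT z|\<mu>. f z * cnj (z $ j))"

lemma trig_measurable_haar: "trig a \<in> borel_measurable \<mu>"
  by (intro measurable_haar trig_measurable)

lemma cnj_nth_measurable_haar: "(\<lambda>z. cnj (z $ j)) \<in> borel_measurable \<mu>"
  by (intro measurable_haar borel_measurable_continuous_onI continuous_intros)

lemma norm_trig_le: "z \<in> torus_hull \<Gamma> \<Longrightarrow> cmod (trig a z) \<le> (\<Sum>j\<in>UNIV. cmod (a $ j))"
  unfolding trig_def by (rule order_trans[OF norm_sum]) (simp add: norm_mult norm_hull_nth)

lemma integrable_bounded_mult_nth:
  assumes [measurable]: "f \<in> borel_measurable \<mu>" and "AE z in \<mu>. cmod (f z) \<le> c"
  shows "integrable \<mu> (\<lambda>z. f z * cnj (z $ j))"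
proof (rule integrable_const_bound[where B = c])
  show "AE z in \<mu>. cmod (f z * cnj (z $ j)) \<le> c"
    using assms(2) AE_space
    by eventually_elim (simp add: norm_mult norm_hull_nth space_haar)
qed (intro borel_measurable_times cnj_nth_measurable_haar assms(1))

lemma coeffs_trig: "coeffs (trig a) = a"
proof -
  have "(LINT z|\<mu>. trig a z * cnj (z $ j)) = a $ j" for j
  proof -
    have "(LINT z|\<mu>. trig a z * cnj (z $ j)) = (LINT z|\<mu>. (\<Sum>i\<in>UNIV. a $ i * (z $ i * cnj (z $ j))))"
      by (simp add: trig_def sum_distrib_right mult.assoc)
    also have "\<dots> = (\<Sum>i\<in>UNIV. a $ i * (if i = j then 1 else 0))"
      by (subst Bochner_Integration.integral_sum)
         (auto intro!: integrable_mult_right integrable_continuous continuous_intros simp: characters_orthonormal)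
    also have "\<dots> = (\<Sum>i\<in>UNIV. if i = j then a $ i else 0)" by (intro sum.cong) auto
    also have "\<dots> = a $ j" by simp
    finally show ?thesis .
  qed
  then show ?thesis by (simp add: coeffs_def vec_eq_iff)
qed

lemma pairing_coeffs:
  assumes f: "f \<in> borel_measurable \<mu>" "AE z in \<mu>. cmod (f z) \<le> c"
  shows "(LINT z|\<mu>. f z * cnj (trig a z)) = (\<Sum>j\<in>UNIV. cnj (a $ j) * coeffs f $ j)"
proof -
  have "(LINT z|\<mu>. f z * cnj (trig a z)) = (LINT z|\<mu>. (\<Sum>j\<in>UNIV. cnj (a $ j) * (f z * cnj (z $ j))))"
    by (simp add: trig_def sum_distrib_left cnj_sum mult_ac)
  also have "\<dots> = (\<Sum>j\<in>UNIV. cnj (a $ j) * coeffs f $ j)"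
    using integrable_bounded_mult_nth[OF f] by (subst Bochner_Integration.integral_sum) (auto simp: coeffs_def)
  finally show ?thesis .
qed

lemma inner_vec_complex: "a \<bullet> v = Re (\<Sum>j\<in>UNIV. cnj (a $ j) * v $ j)" for a v :: "complex ^ 'b::finite"
  by (simp add: inner_vec_def inner_complex_def)

lemma norm_vec_complex_square: "(norm a)\<^sup>2 = Re (\<Sum>j\<in>UNIV. cnj (a $ j) * a $ j)" for a :: "complex ^ 'b::finite"
  by (simp only: inner_vec_complex[symmetric] power2_norm_eq_inner)

lemma norm_trig_L2: "(LINT z|\<mu>. (cmod (trig a z))\<^sup>2) = (norm a)\<^sup>2"
proof -
  have "complex_of_real (LINT z|\<mu>. (cmod (trig a z))\<^sup>2) = (LINT z|\<mu>. trig a z * cnj (trig a z))"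
    by (subst integral_complex_of_real[symmetric]) (simp only: complex_norm_square)
  also have "\<dots> = (\<Sum>j\<in>UNIV. cnj (a $ j) * a $ j)"
    using norm_trig_le
    by (subst pairing_coeffs[where c = "\<Sum>j\<in>UNIV. cmod (a $ j)"])
       (auto simp: coeffs_trig space_haar intro!: trig_measurable_haar AE_I2)
  finally have "(LINT z|\<mu>. (cmod (trig a z))\<^sup>2) = Re (\<Sum>j\<in>UNIV. cnj (a $ j) * a $ j)"
    by (metis Re_complex_of_real)
  then show ?thesis by (simp only: norm_vec_complex_square)
qed

lemma integrable_norm_trig: "integrable \<mu> (\<lambda>z. cmod (trig a z))"
  by (intro integrable_continuous continuous_intros)

text \<open>The variance of \<open>cmod (trig a z)\<close> is nonnegative.\<close>

lemma norm_trig_L1_le: "(LINT z|\<mu>. cmod (trig a z)) \<le> norm a"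
proof -
  let ?m = "LINT z|\<mu>. cmod (trig a z)"
  have "integrable \<mu> (\<lambda>z. (cmod (trig a z))\<^sup>2)"
    by (intro integrable_continuous continuous_intros)
  from variance_eq[OF integrable_norm_trig this] variance_positive[of "\<lambda>z. cmod (trig a z)"]
  have "0 \<le> (norm a)\<^sup>2 - ?m\<^sup>2"
    unfolding norm_trig_L2 by linarith
  then have "?m\<^sup>2 \<le> (norm a)\<^sup>2" by linarith
  then show ?thesis by (rule power2_le_imp_le) simp
qed

lemma Linf_AE:
  assumes "f \<in> Linf \<mu>"
  obtains c where "c \<ge> 0" "Linf_norm \<mu> f = ennreal c" "AE z in \<mu>. cmod (f z) \<le> c"
proof -
  have "Linf_norm \<mu> f < \<infinity>" using assms by (simp add: Linf_def)
  then obtain c where c: "c \<ge> 0" "Linf_norm \<mu> f = ennreal c"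
    by (cases "Linf_norm \<mu> f") auto
  have "AE z in \<mu>. ennreal (cmod (f z)) \<le> ennreal c"
    unfolding c(2)[symmetric] Linf_norm_def by (rule esssup_AE)
  then show ?thesis using that c by simp
qed

text \<open>Pairing \<open>f\<close> with the trigonometric polynomial whose coefficients are those of \<open>f\<close> gives the square of the
norm of the coefficients; the pairing is at most the bound of \<open>f\<close> times the mean of the polynomial.\<close>

lemma norm_coeffs_le_Linf_norm:
  assumes f: "f \<in> Linf \<mu>" shows "ennreal (norm (coeffs f)) \<le> Linf_norm \<mu> f"
proof -
  obtain c where c: "c \<ge> 0" "Linf_norm \<mu> f = ennreal c" "AE z in \<mu>. cmod (f z) \<le> c"
    using Linf_AE[OF f] .
  have fm: "f \<in> borel_measurable \<mu>" using f by (simp add: Linf_def)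
  let ?a = "coeffs f"
  note [measurable] = trig_measurable_haar fm
  have int: "integrable \<mu> (\<lambda>z. c * cmod (trig ?a z))"
    using integrable_norm_trig by simp
  have "(norm ?a)\<^sup>2 = Re (LINT z|\<mu>. f z * cnj (trig ?a z))"
    by (simp only: pairing_coeffs[OF fm c(3)] norm_vec_complex_square)
  also have "\<dots> \<le> cmod (LINT z|\<mu>. f z * cnj (trig ?a z))" by (rule complex_Re_le_cmod)
  also have "\<dots> \<le> (LINT z|\<mu>. c * cmod (trig ?a z))"
  proof (rule order_trans[OF integral_norm_bound integral_mono_AE[OF _ int]])
    show bound: "AE z in \<mu>. norm (f z * cnj (trig ?a z)) \<le> c * cmod (trig ?a z)"
      using c(3) by eventually_elim (simp add: norm_mult mult_right_mono)
    have "(\<lambda>z. cnj (trig ?a z)) \<in> borel_measurable \<mu>"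
      by (intro measurable_haar borel_measurable_continuous_onI continuous_intros)
    then show "integrable \<mu> (\<lambda>z. norm (f z * cnj (trig ?a z)))"
      using bound c(1) by (intro Bochner_Integration.integrable_bound[OF int] borel_measurable_norm borel_measurable_times fm)
        (auto elim!: eventually_mono)
  qed
  also have "\<dots> \<le> c * norm ?a" using norm_trig_L1_le c(1) by (simp add: mult_left_mono)
  finally have "norm ?a * norm ?a \<le> c * norm ?a" by (simp add: power2_eq_square)
  then have "norm ?a \<le> c"
    using c(1) by (cases "norm ?a = 0") auto
  then show ?thesis by (simp add: c(2) ennreal_leI)
qed

definition coeffs_ball :: "real \<Rightarrow> (complex ^ 'm) set" where
  "coeffs_ball c = coeffs ` {f \<in> borel_measurable \<mu>. \<forall>z. cmod (f z) \<le> c}"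

lemma coeffs_linear:
  assumes f: "f \<in> borel_measurable \<mu>" "AE z in \<mu>. cmod (f z) \<le> c"
    and g: "g \<in> borel_measurable \<mu>" "AE z in \<mu>. cmod (g z) \<le> d"
  shows "coeffs (\<lambda>z. u *\<^sub>R f z + v *\<^sub>R g z) = u *\<^sub>R coeffs f + v *\<^sub>R coeffs g"
proof -
  have "(LINT z|\<mu>. (u *\<^sub>R f z + v *\<^sub>R g z) * cnj (z $ j)) =
        (LINT z|\<mu>. u *\<^sub>R (f z * cnj (z $ j)) + v *\<^sub>R (g z * cnj (z $ j)))" for j
    by (simp add: algebra_simps)
  also have "\<dots> j = u *\<^sub>R (LINT z|\<mu>. f z * cnj (z $ j)) + v *\<^sub>R (LINT z|\<mu>. g z * cnj (z $ j))" for j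
    using integrable_bounded_mult_nth[OF f, of j] integrable_bounded_mult_nth[OF g, of j] by simp
  finally show ?thesis by (simp add: coeffs_def vec_eq_iff)
qed

lemma convex_coeffs_ball: "convex (coeffs_ball c)"
proof (rule convexI)
  fix x y u v assume xy: "x \<in> coeffs_ball c" "y \<in> coeffs_ball c" and uv: "0 \<le> u" "0 \<le> v" "u + v = (1::real)"
  obtain f g where f: "f \<in> borel_measurable \<mu>" "\<And>z. cmod (f z) \<le> c" "x = coeffs f"
    and g: "g \<in> borel_measurable \<mu>" "\<And>z. cmod (g z) \<le> c" "y = coeffs g"
    using xy by (auto simp: coeffs_ball_def)
  have "cmod (u *\<^sub>R f z + v *\<^sub>R g z) \<le> c" for z
  proof -
    have "cmod (u *\<^sub>R f z + v *\<^sub>R g z) \<le> u * cmod (f z) + v * cmod (g z)"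
      using norm_triangle_ineq[of "u *\<^sub>R f z" "v *\<^sub>R g z"] uv by simp
    also have "\<dots> \<le> u * c + v * c" using f g uv by (intro add_mono mult_left_mono) auto
    finally show ?thesis using uv by (simp add: distrib_right[symmetric])
  qed
  then show "u *\<^sub>R x + v *\<^sub>R y \<in> coeffs_ball c"
    unfolding coeffs_ball_def f g using f g
    by (intro image_eqI[where x = "\<lambda>z. u *\<^sub>R f z + v *\<^sub>R g z"] coeffs_linear[symmetric, where c = c and d = c]) auto
qed

text \<open>If \<open>r\<close> were outside, a hyperplane with normal \<open>a\<close> would separate it from the convex set of attainable
coefficient vectors. The extremal bounded function in this direction is \<open>-c\<close> times the phase of
\<open>trig a\<close>, so the separation contradicts the hypothesis for this \<open>a\<close>.\<close>

lemma dual_bound_imp_closure: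
  assumes c: "c \<ge> 0" and dual: "\<And>a. cmod (\<Sum>j\<in>UNIV. cnj (a $ j) * r $ j) \<le> c * (LINT z|\<mu>. cmod (trig a z))"
  shows "r \<in> closure (coeffs_ball c)"
proof (rule ccontr)
  assume "r \<notin> closure (coeffs_ball c)"
  then obtain a b where ab: "a \<bullet> r < b" "\<And>v. v \<in> closure (coeffs_ball c) \<Longrightarrow> a \<bullet> v > b"
    using separating_hyperplane_closed_point[of "closure (coeffs_ball c)" r] convex_coeffs_ball
    by (auto simp: convex_closure)
  define f where "f z = - (c *\<^sub>R sgn (trig a z))" for z
  note [measurable] = trig_measurable_haar
  have fm: "f \<in> borel_measurable \<mu>" unfolding f_def[abs_def] by measurable
  have fb: "cmod (f z) \<le> c" for z using c by (simp add: f_def norm_sgn)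
  have "coeffs f \<in> coeffs_ball c" using fm fb by (auto simp: coeffs_ball_def)
  then have "b < a \<bullet> coeffs f" using ab(2) closure_subset by blast
  also have "a \<bullet> coeffs f = Re (LINT z|\<mu>. f z * cnj (trig a z))"
    by (subst pairing_coeffs[OF fm, of c]) (auto simp: fb inner_vec_complex)
  also have "(LINT z|\<mu>. f z * cnj (trig a z)) = (LINT z|\<mu>. complex_of_real (- c * cmod (trig a z)))"
  proof (intro Bochner_Integration.integral_cong refl)
    fix z
    show "f z * cnj (trig a z) = complex_of_real (- c * cmod (trig a z))"
    proof (cases "trig a z = 0")
      case False
      have "sgn (trig a z) * cnj (trig a z) = complex_of_real (cmod (trig a z))"
        using False by (simp add: sgn_eq complex_norm_square[symmetric] power2_eq_square field_simps)
      then show ?thesis by (simp add: f_def scaleR_conv_of_real mult.assoc)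
    qed (simp add: f_def)
  qed
  also have "Re \<dots> = - (c * (LINT z|\<mu>. cmod (trig a z)))"
    by (subst integral_complex_of_real) simp
  finally have "b < - (c * (LINT z|\<mu>. cmod (trig a z)))" .
  moreover have "\<bar>a \<bullet> r\<bar> \<le> c * (LINT z|\<mu>. cmod (trig a z))"
    using dual[of a] abs_Re_le_cmod order_trans unfolding inner_vec_complex by blast
  ultimately show False using ab(1) by linarith
qed

text \<open>A vector of the closure is attained exactly once the bound is relaxed: the small remaining error in the
coefficients is corrected by a trigonometric polynomial, which is small everywhere. This replaces a weak
compactness argument, at the price of an \<open>e\<close> that the infimum absorbs.\<close>

lemma closure_coeffs_ball_interpolation:
  assumes r: "r \<in> closure (coeffs_ball c)" and c: "c \<ge> 0" and e: "e > 0"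
  shows "\<exists>f\<in>Linf \<mu>. coeffs f = r \<and> Linf_norm \<mu> f \<le> ennreal (c + e)"
proof -
  define N where "N = real CARD('m)"
  have N: "N > 0" by (simp add: N_def)
  \<comment> \<open>Each of the \<open>N\<close> terms of the correcting polynomial may contribute \<open>e / N\<close>.\<close>
  obtain v where v: "v \<in> coeffs_ball c" "dist v r < e / N"
    using r N e unfolding closure_approachable by (metis divide_pos_pos)
  obtain f where f: "f \<in> borel_measurable \<mu>" "\<And>z. cmod (f z) \<le> c" "v = coeffs f"
    using v by (auto simp: coeffs_ball_def)
  define g where "g z = 1 *\<^sub>R f z + 1 *\<^sub>R trig (r - v) z" for z
  note [measurable] = trig_measurable_haar f(1)
  have tb: "cmod (trig (r - v) z) \<le> e" if "z \<in> torus_hull \<Gamma>" for z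
  proof -
    have "cmod (trig (r - v) z) \<le> (\<Sum>j\<in>UNIV. cmod ((r - v) $ j))" using that by (rule norm_trig_le)
    also have "\<dots> \<le> (\<Sum>j\<in>(UNIV::'m set). e / N)"
      using v(2) by (intro sum_mono order_trans[OF Finite_Cartesian_Product.norm_nth_le]) (simp add: dist_norm norm_minus_commute)
    finally show ?thesis using N by (simp add: N_def)
  qed
  have gb: "AE z in \<mu>. cmod (g z) \<le> c + e"
    using tb f(2) by (intro AE_I2) (auto simp: g_def space_haar intro!: order_trans[OF norm_triangle_ineq] add_mono)
  have gm [measurable]: "g \<in> borel_measurable \<mu>" unfolding g_def[abs_def] by measurable
  have "Linf_norm \<mu> g \<le> ennreal (c + e)"
    unfolding Linf_norm_def using gb by (intro esssup_I) (auto elim!: eventually_mono intro: ennreal_leI)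
  moreover have "coeffs g = r"
  proof -
    have "coeffs g = 1 *\<^sub>R coeffs f + 1 *\<^sub>R coeffs (trig (r - v))"
      unfolding g_def[abs_def] using tb f(2)
      by (intro coeffs_linear[where c = c and d = e] f(1) trig_measurable_haar AE_I2) (auto simp: space_haar)
    then show ?thesis by (simp add: coeffs_trig f(3))
  qed
  moreover have "g \<in> Linf \<mu>"
    using \<open>Linf_norm \<mu> g \<le> _\<close> by (auto simp: Linf_def le_less_trans)
  ultimately show ?thesis by blast
qed

end

section \<open>From residues to the dual bound\<close>

lemma borel_measurable_cnj [measurable]: "cnj \<in> borel_measurable borel"
  by (intro borel_measurable_continuous_onI continuous_intros)

lemma borel_imp_measurable_lebesgue_on:
  "f \<in> borel_measurable borel \<Longrightarrow> f \<in> borel_measurable (lebesgue_on S)"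
  by (rule measurable_restrict_space1, rule measurable_completion) simp

text \<open>The essential supremum over \<open>[X, \<infinity>)\<close> decreases in \<open>X\<close> once \<open>X \<ge> 1\<close>, so the limit is the infimum
over these \<open>X\<close>.\<close>

lemma ess_growth_less_imp_AE:
  assumes E: "E \<in> borel_measurable (lebesgue_on {1..})"
    and less: "ess_growth \<beta> E < ennreal c"
  shows "\<exists>X\<ge>1. AE x in lebesgue. x \<ge> X \<longrightarrow> cmod (E x) \<le> c * x powr \<beta>"
proof -
  let ?\<phi> = "\<lambda>x. ennreal (cmod (E x) / x powr \<beta>)"
  define S where "S X = esssup (mult_measure_from X) ?\<phi>" for X
  have AE_iff: "(AE x in mult_measure_from X. P x) \<longleftrightarrow> (AE x in lebesgue. x \<ge> X \<longrightarrow> P x)"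
    if X: "X \<ge> 1" for X P
  proof -
    have "(AE x in mult_measure_from X. P x) \<longleftrightarrow> (AE x in lebesgue_on {X..}. 0 < ennreal (1 / x) \<longrightarrow> P x)"
      unfolding mult_measure_from_def
      by (intro AE_density borel_imp_measurable_lebesgue_on) measurable
    also have "\<dots> \<longleftrightarrow> (AE x in lebesgue. x \<in> {X..} \<longrightarrow> 0 < ennreal (1 / x) \<longrightarrow> P x)"
      by (rule AE_restrict_space_iff) auto
    also have "\<dots> \<longleftrightarrow> (AE x in lebesgue. x \<ge> X \<longrightarrow> P x)"
      using X by (intro AE_cong) auto
    finally show ?thesis .
  qed
  have meas: "?\<phi> \<in> borel_measurable (mult_measure_from X)" if "X \<ge> 1" for X
  proof -
    have [measurable]: "E \<in> borel_measurable (lebesgue_on {X..})"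
      using that by (intro measurable_restrict_mono[OF E]) auto
    have [measurable]: "(\<lambda>x. x powr \<beta>) \<in> borel_measurable (lebesgue_on {X..})"
      by (intro borel_imp_measurable_lebesgue_on) measurable
    have "?\<phi> \<in> borel_measurable (lebesgue_on {X..})" by measurable
    then show ?thesis by (simp add: mult_measure_from_def)
  qed
  have anti: "S Y \<le> S X" if "1 \<le> X" "X \<le> Y" for X Y
  proof -
    have "AE x in mult_measure_from X. ?\<phi> x \<le> S X" unfolding S_def by (rule esssup_AE)
    then have "AE x in mult_measure_from Y. ?\<phi> x \<le> S X"
      using that by (subst (asm) AE_iff, simp) (subst AE_iff, simp, auto elim!: eventually_mono)
    then show ?thesis using that unfolding S_def[of Y] by (intro esssup_I meas) auto
  qed
  have "(S \<longlongrightarrow> (INF X\<in>{1..}. S X)) at_top"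
  proof (rule decreasing_tendsto)
    show "\<forall>\<^sub>F X in at_top. (INF X\<in>{1..}. S X) \<le> S X"
      using eventually_ge_at_top[of 1] by eventually_elim (auto intro: INF_lower)
    fix x assume "(INF X\<in>{1..}. S X) < x"
    then obtain X where X: "X \<ge> 1" "S X < x" by (auto simp: INF_less_iff)
    show "\<forall>\<^sub>F Y in at_top. S Y < x"
      using eventually_ge_at_top[of X] by eventually_elim (use X anti le_less_trans in blast)
  qed
  then have "ess_growth \<beta> E = (INF X\<in>{1..}. S X)"
    unfolding ess_growth_def S_def by (intro tendsto_Lim) auto
  then obtain X where X: "X \<ge> 1" "S X < ennreal c" using less by (auto simp: INF_less_iff)
  have "AE x in mult_measure_from X. ?\<phi> x \<le> S X" unfolding S_def by (rule esssup_AE)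
  then have "AE x in lebesgue. x \<ge> X \<longrightarrow> ?\<phi> x \<le> S X" using X by (simp add: AE_iff)
  then have "AE x in lebesgue. x \<ge> X \<longrightarrow> cmod (E x) \<le> c * x powr \<beta>"
  proof eventually_elim
    case (elim x)
    show ?case
    proof
      assume x: "x \<ge> X"
      then have "?\<phi> x < ennreal c" using elim X by (auto intro: le_less_trans)
      then have "cmod (E x) / x powr \<beta> < c" by (subst (asm) ennreal_less_iff) auto
      moreover have "x powr \<beta> > 0" using x X by simp
      ultimately show "cmod (E x) \<le> c * x powr \<beta>" by (simp add: field_simps)
    qed
  qed
  with X show ?thesis by blast
qed

text \<open>For a simple pole, \<open>zor_poly F \<rho>\<close> is the continuous extension of \<open>(s - \<rho>) * F s\<close> and its value at \<open>\<rho>\<close> is the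
residue; approaching \<open>\<rho>\<close> horizontally from the right stays in the region where \<open>F\<close> agrees with \<open>M\<close>.\<close>

lemma simple_pole_residue_limit:
  assumes "open U" "\<rho> \<in> U" "F meromorphic_on U"
    and "has_simple_pole_with_residue F \<rho> c"
    and agree: "\<And>s. s \<in> U \<Longrightarrow> Re s > Re \<rho> \<Longrightarrow> F s = M s"
  shows "((\<lambda>\<delta>. complex_of_real \<delta> * M (\<rho> + complex_of_real \<delta>)) \<longlongrightarrow> c) (at_right 0)"
proof -
  have iso: "isolated_singularity_at F \<rho>"
    using assms(2,3) by (auto simp: meromorphic_on_altdef)
  have pole: "is_pole F \<rho>" "zorder F \<rho> = -1" "residue F \<rho> = c"
    using assms(4) by (auto simp: has_simple_pole_with_residue_def)
  obtain e where e: "e > 0" "F holomorphic_on ball \<rho> e - {\<rho>}"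
    using iso analytic_imp_holomorphic unfolding isolated_singularity_at_def by blast
  from zorder_exist_pole[OF e(2) _ _ pole(1)] e(1) pole(2)
  obtain r where r: "r > 0" "zor_poly F \<rho> holomorphic_on cball \<rho> r"
    and F: "\<And>w. w \<in> cball \<rho> r - {\<rho>} \<Longrightarrow> F w = zor_poly F \<rho> w / (w - \<rho>)"
    by auto
  have lim: "((\<lambda>\<delta>. \<rho> + complex_of_real \<delta>) \<longlongrightarrow> \<rho>) (at_right 0)"
    by (rule tendsto_eq_intros refl)+ simp
  have "isCont (zor_poly F \<rho>) \<rho>"
  proof -
    have "zor_poly F \<rho> holomorphic_on ball \<rho> r"
      using r(2) ball_subset_cball holomorphic_on_subset by blast
    then show ?thesis
      using r(1) by (meson centre_in_ball continuous_on_eq_continuous_at holomorphic_on_imp_continuous_on open_ball)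
  qed
  then have "((\<lambda>\<delta>. zor_poly F \<rho> (\<rho> + complex_of_real \<delta>)) \<longlongrightarrow> zor_poly F \<rho> \<rho>) (at_right 0)"
    using lim by (rule isCont_tendsto_compose)
  moreover have "zor_poly F \<rho> \<rho> = c"
    using residue_simple_pole[OF iso pole(1,2)] pole(3) by simp
  moreover have "\<forall>\<^sub>F \<delta> in at_right 0. zor_poly F \<rho> (\<rho> + complex_of_real \<delta>) = complex_of_real \<delta> * M (\<rho> + complex_of_real \<delta>)"
  proof -
    have "\<forall>\<^sub>F \<delta> in at_right 0. \<rho> + complex_of_real \<delta> \<in> U \<inter> ball \<rho> r"
      using assms(1,2) r(1) by (intro topological_tendstoD[OF lim]) auto
    with eventually_at_right_less[of 0] show ?thesis
    proof eventually_elim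
      case (elim \<delta>)
      then have "\<rho> + complex_of_real \<delta> \<in> cball \<rho> r - {\<rho>}" by auto
      from F[OF this] agree[of "\<rho> + complex_of_real \<delta>"] elim show ?case
        by (simp add: field_simps)
    qed
  qed
  ultimately show ?thesis by (auto elim: Lim_transform_eventually)
qed

lemma mellin_integrand:
  assumes "x \<ge> 1"
  shows "E x * complex_of_real x powr (- Complex \<sigma> (\<Gamma> $ j) - 1)
      = complex_of_real (x powr (- \<sigma> - 1)) * (E x * cnj (torus_curve \<Gamma> (ln x) $ j))"
proof -
  have "complex_of_real x powr (- Complex \<sigma> (\<Gamma> $ j) - 1) = exp ((- Complex \<sigma> (\<Gamma> $ j) - 1) * complex_of_real (ln x))"
    using assms by (simp add: powr_def Ln_of_real)
  also have "(- Complex \<sigma> (\<Gamma> $ j) - 1) * complex_of_real (ln x)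
      = complex_of_real ((- \<sigma> - 1) * ln x) + \<i> * complex_of_real (- (\<Gamma> $ j * ln x))"
    by (simp add: complex_eq_iff algebra_simps)
  also have "exp \<dots> = complex_of_real (exp ((- \<sigma> - 1) * ln x)) * cis (- (\<Gamma> $ j * ln x))"
    by (simp only: exp_add exp_of_real cis_conv_exp)
  also have "\<dots> = complex_of_real (x powr (- \<sigma> - 1)) * cnj (torus_curve \<Gamma> (ln x) $ j)"
    using assms by (simp add: torus_curve_nth cis_cnj powr_def)
  finally show ?thesis by (simp add: mult_ac)
qed

lemma mellin_trig:
  assumes E: "E \<in> borel_measurable (lebesgue_on {1..})"
    and int: "integrable (lebesgue_on {1..}) (\<lambda>x. cmod (E x) * x powr (- \<sigma> - 1))"
  shows "(\<Sum>j\<in>UNIV. cnj (a $ j) * mellin E (Complex \<sigma> (\<Gamma> $ j)))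
      = (LINT x|lebesgue_on {1..}. complex_of_real (x powr (- \<sigma> - 1)) * (E x * cnj (trig a (torus_curve \<Gamma> (ln x)))))"
proof -
  let ?L = "lebesgue_on {1::real..}"
  let ?F = "\<lambda>j x. complex_of_real (x powr (- \<sigma> - 1)) * (E x * cnj (torus_curve \<Gamma> (ln x) $ j))"
  have F: "integrable ?L (?F j)" for j
  proof (rule Bochner_Integration.integrable_bound[OF int])
    have "(\<lambda>x. complex_of_real (x powr (- \<sigma> - 1))) \<in> borel_measurable ?L"
      by (intro borel_imp_measurable_lebesgue_on) measurable
    moreover have "(\<lambda>x. cnj (torus_curve \<Gamma> (ln x) $ j)) \<in> borel_measurable ?L"
      by (intro borel_imp_measurable_lebesgue_on) measurable
    ultimately show "?F j \<in> borel_measurable ?L" using E by (intro borel_measurable_times)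
  qed (auto simp: norm_mult torus_curve_nth)
  have "mellin E (Complex \<sigma> (\<Gamma> $ j)) = (LINT x|?L. ?F j x)" for j
    unfolding mellin_def
    by (rule Bochner_Integration.integral_cong[OF refl]) (simp add: mellin_integrand space_restrict_space)
  then have "(\<Sum>j\<in>UNIV. cnj (a $ j) * mellin E (Complex \<sigma> (\<Gamma> $ j))) = (LINT x|?L. (\<Sum>j\<in>UNIV. cnj (a $ j) * ?F j x))"
    using F by (subst Bochner_Integration.integral_sum) auto
  also have "\<dots> = (LINT x|?L. complex_of_real (x powr (- \<sigma> - 1)) * (E x * cnj (trig a (torus_curve \<Gamma> (ln x)))))"
    by (simp add: trig_def sum_distrib_left mult_ac)
  finally show ?thesis .
qed

lemma lebesgue_on_pareto:
  fixes h :: "real \<Rightarrow> real"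
  assumes \<delta>: "\<delta> > 0" and [measurable]: "h \<in> borel_measurable borel" and B: "\<And>x. \<bar>h x\<bar> \<le> B"
  shows "integrable (lebesgue_on {1..}) (\<lambda>x. \<delta> * x powr (- \<delta> - 1) * h x)"
    and "(LINT x|lebesgue_on {1..}. \<delta> * x powr (- \<delta> - 1) * h x) = (LINT x|pareto \<delta>. h x)"
proof -
  have eq: "indicator {1..} x *\<^sub>R (\<delta> * x powr (- \<delta> - 1) * h x) = pareto_density \<delta> x *\<^sub>R h x" for x
    by (simp add: pareto_density_def)
  interpret prob_space "pareto \<delta>" using \<delta> by (rule prob_space_pareto)
  have "integrable (pareto \<delta>) h"
    using B by (intro integrable_const_bound[where B = B]) auto
  then have "integrable lborel (\<lambda>x. pareto_density \<delta> x *\<^sub>R h x)"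
    unfolding pareto_def using \<delta> by (subst (asm) integrable_density) (auto simp: pareto_density_nonneg)
  then show "integrable (lebesgue_on {1..}) (\<lambda>x. \<delta> * x powr (- \<delta> - 1) * h x)"
    by (subst integrable_restrict_space, simp) (unfold eq, subst integrable_completion, auto)
  show "(LINT x|lebesgue_on {1..}. \<delta> * x powr (- \<delta> - 1) * h x) = (LINT x|pareto \<delta>. h x)"
    by (subst integral_restrict_space, simp) (unfold eq, subst integral_completion, auto simp: integral_pareto[OF \<delta>])
qed

context torus_haar_distinct
begin

text \<open>The combination of residues is the limit of \<open>\<delta>\<close> times the same combination of Mellin transforms, that is of the
integral of \<open>E\<close> against the conjugate of \<open>trig a\<close> along the curve. Beyond \<open>X\<close> the factor \<open>E\<close> is at most
\<open>c * x powr \<beta>\<close>, which leaves \<open>c\<close> times an average of \<open>cmod (trig a)\<close>, to which equidistribution applies; the part up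
to \<open>X\<close> stays bounded and is killed by \<open>\<delta>\<close>.\<close>

lemma residue_dual_bound:
  assumes E: "E \<in> borel_measurable (lebesgue_on {1..})"
    and int: "\<And>\<sigma>. \<sigma> > \<beta> \<Longrightarrow> integrable (lebesgue_on {1..}) (\<lambda>x. cmod (E x) * x powr (- \<sigma> - 1))"
    and res: "\<And>j. ((\<lambda>\<delta>. complex_of_real \<delta> * mellin E (Complex \<beta> (\<Gamma> $ j) + complex_of_real \<delta>)) \<longlongrightarrow> r $ j) (at_right 0)"
    and c: "c \<ge> 0" and growth: "ess_growth \<beta> E < ennreal c"
  shows "cmod (\<Sum>j\<in>UNIV. cnj (a $ j) * r $ j) \<le> c * (LINT z|\<mu>. cmod (trig a z))"
proof -
  let ?L = "lebesgue_on {1::real..}"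
  let ?t = "\<lambda>x. trig a (torus_curve \<Gamma> (ln x))"
  obtain X where X: "X \<ge> 1" and AE_E: "AE x in lebesgue. x \<ge> X \<longrightarrow> cmod (E x) \<le> c * x powr \<beta>"
    using ess_growth_less_imp_AE[OF E growth] by blast
  define B where "B = (\<Sum>j\<in>UNIV. cmod (a $ j))"
  have B: "cmod (?t x) \<le> B" for x
    unfolding B_def by (intro norm_trig_le torus_curve_in_hull)
  have B0: "B \<ge> 0" by (simp add: B_def sum_nonneg)
  \<comment> \<open>The part up to \<open>X\<close> is compared with the convergent integral at abscissa \<open>\<beta> + 1\<close>.\<close>
  define K where "K = (LINT x|?L. cmod (E x) * x powr (- (\<beta> + 1) - 1))"
  have K: "integrable ?L (\<lambda>x. cmod (E x) * x powr (- (\<beta> + 1) - 1))" by (rule int) simp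
  let ?I = "\<lambda>\<delta>. \<Sum>j\<in>UNIV. cnj (a $ j) * (complex_of_real \<delta> * mellin E (Complex \<beta> (\<Gamma> $ j) + complex_of_real \<delta>))"
  have bound: "cmod (?I \<delta>) \<le> \<delta> * (B * X * K) + c * (LINT x|pareto \<delta>. cmod (?t x))" if \<delta>: "\<delta> > 0" for \<delta>
  proof -
    let ?f = "\<lambda>x. complex_of_real (x powr (- (\<beta> + \<delta>) - 1)) * (E x * cnj (?t x))"
    let ?g = "\<lambda>x. B * X * (cmod (E x) * x powr (- (\<beta> + 1) - 1)) + c / \<delta> * (\<delta> * x powr (- \<delta> - 1) * cmod (?t x))"
    note P = lebesgue_on_pareto[OF \<delta>, of "\<lambda>x. cmod (?t x)" B]
    have t: "(\<lambda>x. cmod (?t x)) \<in> borel_measurable borel" by measurable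
    have "Complex \<beta> y + complex_of_real \<delta> = Complex (\<beta> + \<delta>) y" for y by (simp add: complex_eq_iff)
    then have "?I \<delta> = complex_of_real \<delta> * (\<Sum>j\<in>UNIV. cnj (a $ j) * mellin E (Complex (\<beta> + \<delta>) (\<Gamma> $ j)))"
      by (simp add: sum_distrib_left mult_ac)
    also have "\<dots> = complex_of_real \<delta> * (LINT x|?L. ?f x)"
      using \<delta> by (subst mellin_trig[OF E int]) auto
    finally have I: "cmod (?I \<delta>) = \<delta> * cmod (LINT x|?L. ?f x)" using \<delta> by (simp add: norm_mult)
    have le: "cmod (LINT x|?L. ?f x) \<le> (LINT x|?L. ?g x)"
    proof (rule order_trans[OF integral_norm_bound integral_mono_AE])
      show "integrable ?L (\<lambda>x. cmod (?f x))"
      proof (rule Bochner_Integration.integrable_bound)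
        show "integrable ?L (\<lambda>x. B * (cmod (E x) * x powr (- (\<beta> + \<delta>) - 1)))"
          using int[of "\<beta> + \<delta>"] \<delta> by simp
        have "(\<lambda>x. complex_of_real (x powr (- (\<beta> + \<delta>) - 1))) \<in> borel_measurable ?L"
          by (intro borel_imp_measurable_lebesgue_on) measurable
        moreover have "(\<lambda>x. cnj (?t x)) \<in> borel_measurable ?L"
          by (intro borel_imp_measurable_lebesgue_on) measurable
        ultimately show "(\<lambda>x. cmod (?f x)) \<in> borel_measurable ?L"
          using E by measurable
        show "AE x in ?L. norm (cmod (?f x)) \<le> norm (B * (cmod (E x) * x powr (- (\<beta> + \<delta>) - 1)))"
        proof (rule AE_I2)
          fix x
          have "cmod (?t x) * (cmod (E x) * x powr (- (\<beta> + \<delta>) - 1)) \<le> B * (cmod (E x) * x powr (- (\<beta> + \<delta>) - 1))"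
            using B[of x] by (intro mult_right_mono) auto
          then show "norm (cmod (?f x)) \<le> norm (B * (cmod (E x) * x powr (- (\<beta> + \<delta>) - 1)))"
            using B0 by (simp add: norm_mult abs_mult mult_ac)
        qed
      qed
      show "integrable ?L ?g"
        using K P(1)[OF t] B by (intro Bochner_Integration.integrable_add integrable_mult_right) auto
      have "AE x in ?L. x \<ge> X \<longrightarrow> cmod (E x) \<le> c * x powr \<beta>"
        by (subst AE_restrict_space_iff) (use AE_E in auto)
      with AE_space show "AE x in ?L. cmod (?f x) \<le> ?g x"
      proof eventually_elim
        case (elim x)
        then have x: "x \<ge> 1" by (simp add: space_restrict_space)
        have f: "cmod (?f x) = cmod (E x) * x powr (- (\<beta> + \<delta>) - 1) * cmod (?t x)"
          by (simp add: norm_mult)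
        show ?case
        proof (cases "x \<ge> X")
          case True
          have "cmod (E x) * x powr (- (\<beta> + \<delta>) - 1) \<le> c * x powr \<beta> * x powr (- (\<beta> + \<delta>) - 1)"
            using elim True by (intro mult_right_mono) auto
          also have "\<dots> = c * x powr (- \<delta> - 1)" using x by (simp add: powr_add[symmetric])
          finally have "cmod (?f x) \<le> c * x powr (- \<delta> - 1) * cmod (?t x)"
            unfolding f by (intro mult_right_mono) auto
          also have "\<dots> \<le> ?g x" using \<delta> B0 X by simp
          finally show ?thesis .
        next
          case False
          have "x powr (- (\<beta> + \<delta>) - 1) = x powr (- (\<beta> + 1) - 1) * x powr (1 - \<delta>)"
            using x by (simp add: powr_add[symmetric])
          also have "x powr (1 - \<delta>) \<le> X"
            using powr_mono[of "1 - \<delta>" 1 x] x \<delta> False by simp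
          finally have "x powr (- (\<beta> + \<delta>) - 1) \<le> x powr (- (\<beta> + 1) - 1) * X"
            by (simp add: mult_left_mono)
          then have "cmod (E x) * x powr (- (\<beta> + \<delta>) - 1) * cmod (?t x) \<le> cmod (E x) * (x powr (- (\<beta> + 1) - 1) * X) * B"
            using B[of x] X by (intro mult_mono mult_left_mono) auto
          also have "\<dots> \<le> ?g x" using \<delta> c by (simp add: mult_ac)
          finally show ?thesis unfolding f .
        qed
      qed
    qed
    have "(LINT x|?L. ?g x) = (LINT x|?L. B * X * (cmod (E x) * x powr (- (\<beta> + 1) - 1)))
        + (LINT x|?L. c / \<delta> * (\<delta> * x powr (- \<delta> - 1) * cmod (?t x)))"
      using K P(1)[OF t] B by (intro Bochner_Integration.integral_add integrable_mult_right) auto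
    moreover have "(LINT x|?L. c / \<delta> * (\<delta> * x powr (- \<delta> - 1) * cmod (?t x))) = c / \<delta> * (LINT x|pareto \<delta>. cmod (?t x))"
      using P(2)[OF t] B by (subst integral_mult_right_zero) simp
    ultimately have "(LINT x|?L. ?g x) = B * X * K + c / \<delta> * (LINT x|pareto \<delta>. cmod (?t x))"
      by (simp add: K_def)
    with le have "\<delta> * cmod (LINT x|?L. ?f x) \<le> \<delta> * (B * X * K + c / \<delta> * (LINT x|pareto \<delta>. cmod (?t x)))"
      using \<delta> by (intro mult_left_mono) auto
    with I show ?thesis using \<delta> by (simp add: distrib_left)
  qed
  have "((\<lambda>\<delta>. cmod (?I \<delta>)) \<longlongrightarrow> cmod (\<Sum>j\<in>UNIV. cnj (a $ j) * r $ j)) (at_right 0)"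
    by (intro tendsto_intros res)
  moreover have "((\<lambda>\<delta>. \<delta> * (B * X * K) + c * (LINT x|pareto \<delta>. cmod (?t x)))
      \<longlongrightarrow> 0 * (B * X * K) + c * (LINT z|\<mu>. cmod (trig a z))) (at_right 0)"
    by (intro tendsto_intros equidistribution continuous_intros)
  moreover have "\<forall>\<^sub>F \<delta> in at_right 0. cmod (?I \<delta>) \<le> \<delta> * (B * X * K) + c * (LINT x|pareto \<delta>. cmod (?t x))"
    using eventually_at_right_less[of 0] by eventually_elim (rule bound)
  ultimately show ?thesis
    using tendsto_le[OF trivial_limit_at_right_real] by fastforce
qed

end

theorem corollary33p4:
  fixes E :: "real \<Rightarrow> complex" and \<beta> :: real
    and \<Gamma> :: "real ^ 'm::finite" and r :: "complex ^ 'm"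
  assumes "E \<in> borel_measurable (lebesgue_on {1..})"
    and "\<And>\<sigma>. \<sigma> > \<beta> \<Longrightarrow> integrable (lebesgue_on {1..}) (\<lambda>x. cmod (E x) * x powr (- \<sigma> - 1))"
    and "\<And>i j. i \<noteq> j \<Longrightarrow> \<Gamma> $ i \<noteq> \<Gamma> $ j"
    and "\<And>j. \<exists>U F. open U \<and> Complex \<beta> (\<Gamma> $ j) \<in> U \<and> F meromorphic_on U \<and>
           (\<forall>s\<in>U. Re s > \<beta> \<longrightarrow> F s = mellin E s) \<and>
           has_simple_pole_with_residue F (Complex \<beta> (\<Gamma> $ j)) (r $ j)"
  shows "ess_growth \<beta> E \<ge> q_interp \<Gamma> r \<and> q_interp \<Gamma> r \<ge> ennreal (norm r)"
proof
  let ?\<mu> = "haar_prob (torus_hull \<Gamma>)"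
  interpret torus_haar_distinct \<Gamma> ?\<mu>
    by unfold_locales (auto simp: is_haar_prob_haar_prob assms(3))
  have q: "q_interp \<Gamma> r = Inf {Linf_norm ?\<mu> f | f. f \<in> Linf ?\<mu> \<and> coeffs f = r}"
    by (simp add: q_interp_def Let_def coeffs_def vec_eq_iff)
  show "ennreal (norm r) \<le> q_interp \<Gamma> r"
    unfolding q using norm_coeffs_le_Linf_norm by (intro Inf_greatest) auto
  have res: "((\<lambda>\<delta>. complex_of_real \<delta> * mellin E (Complex \<beta> (\<Gamma> $ j) + complex_of_real \<delta>)) \<longlongrightarrow> r $ j) (at_right 0)" for j
    using assms(4)[of j] by (auto intro: simple_pole_residue_limit)
  show "q_interp \<Gamma> r \<le> ess_growth \<beta> E"
  proof (rule dense_ge)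
    fix y assume y: "ess_growth \<beta> E < y"
    show "q_interp \<Gamma> r \<le> y"
    proof (cases "y = \<infinity>")
      case False
      then obtain d where d: "y = ennreal d" "d \<ge> 0" by (cases y) auto
      obtain z where z: "ess_growth \<beta> E < z" "z < y" using dense[OF y] by blast
      then obtain c where c: "z = ennreal c" "c \<ge> 0" using False by (cases z) auto
      have cd: "c < d" using z(2) c d by (simp add: ennreal_less_iff)
      have "r \<in> closure (coeffs_ball c)"
        using residue_dual_bound[OF assms(1,2) res c(2)] z(1) c by (intro dual_bound_imp_closure) auto
      from closure_coeffs_ball_interpolation[OF this c(2), of "d - c"] cd
      obtain f where "f \<in> Linf ?\<mu>" "coeffs f = r" "Linf_norm ?\<mu> f \<le> ennreal d" by auto
      then show ?thesis unfolding q d(1) by (intro Inf_lower2[of "Linf_norm ?\<mu> f"]) auto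
    qed simp
  qed
qed

end
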